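(* Let $n$ be an even positive integer and let $\mathscr{T}_{n,n/2}$ be the set of all trees on $n$ vertices with domination number $n/2$. Among all trees in $\mathscr{T}_{n,n/2}$, the tree $P_{n/2}\circ K_1$ (the path on $n/2$ vertices with one pendant vertex attached to each of its vertices) has the maximal eccentric distance sum.
   Context: All graphs are simple and connected. For a graph $G$ and vertices $u,v$, $d_G(u,v)$ is the distance between $u$ and $v$; $D_G(v)=\sum_{u\in V_G}d_G(u,v)$; the eccentricity $\varepsilon_G(v)$ is the maximum distance from $v$ to any vertex. The eccentric distance sum is $\xi^d(G)=\sum_{v\in V_G}\varepsilon_G(v)D_G(v)$. The domination number of $G$ is the minimum size of a set $S\subseteq V_G$ such that every vertex outside $S$ is adjacent to a vertex of $S$. For a graph $H$, $H\circ K_1$ is the graph obtained from $H$ by attaching one leaf to each vertex of $H$. *)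

theory Defs
  imports "Graph_Theory.Digraph_Component"
begin

text \<open>
  A finite simple graph is a \<^locale>\<open>pair_graph\<close>: a finite digraph on pairs that is symmetric and
  loop-free, each undirected edge being represented by its two opposite arcs.
\<close>

definition gdist :: "'a pair_pre_digraph \<Rightarrow> 'a \<Rightarrow> 'a \<Rightarrow> nat" where
  "gdist G u v = (LEAST k. \<exists>p. pre_digraph.awalk (with_proj G) u p v \<and> length p = k)"

definition dist_sum :: "'a pair_pre_digraph \<Rightarrow> 'a \<Rightarrow> nat" where
  "dist_sum G v = (\<Sum>u\<in>pverts G. gdist G u v)"

definition eccentricity :: "'a pair_pre_digraph \<Rightarrow> 'a \<Rightarrow> nat" where
  "eccentricity G v = Max ((\<lambda>u. gdist G v u) ` pverts G)"

definition ecc_dist_sum :: "'a pair_pre_digraph \<Rightarrow> nat" where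
  "ecc_dist_sum G = (\<Sum>v\<in>pverts G. eccentricity G v * dist_sum G v)"

definition dominating_set :: "'a pair_pre_digraph \<Rightarrow> 'a set \<Rightarrow> bool" where
  "dominating_set G S \<longleftrightarrow>
     S \<subseteq> pverts G \<and> (\<forall>v\<in>pverts G - S. \<exists>s\<in>S. (v, s) \<in> parcs G)"

definition domination_number :: "'a pair_pre_digraph \<Rightarrow> nat" where
  "domination_number G = Min (card ` {S. dominating_set G S})"

text \<open>
  The library's \<^const>\<open>tree\<close> cannot be used for undirected graphs: its notion of cycle admits the
  closed walk u, v, u along the two arcs of a single edge.  Hence only cycles of length
  at least 3 are excluded here.
\<close>

definition undirected_tree :: "'a pair_pre_digraph \<Rightarrow> bool" where
  "undirected_tree G \<longleftrightarrow>
     pair_graph G \<and> Digraph_Component.connected (with_proj G) \<and>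
     \<not> (\<exists>p. pre_digraph.cycle (with_proj G) p \<and> 3 \<le> length p)"

definition trees_with_domination :: "nat \<Rightarrow> nat \<Rightarrow> 'a pair_pre_digraph set" where
  "trees_with_domination n k =
     {T. undirected_tree T \<and> card (pverts T) = n \<and> domination_number T = k}"

definition path_graph :: "nat \<Rightarrow> nat pair_pre_digraph" where
  "path_graph k =
     \<lparr> pverts = {..<k}, parcs = {(i, j). i < k \<and> j < k \<and> (j = Suc i \<or> i = Suc j)} \<rparr>"

text \<open>
  The corona of H with the one-vertex graph: (u, False) is the copy of the vertex u of H,
  and (u, True) is the leaf attached to it.
\<close>

definition corona_K1 :: "'a pair_pre_digraph \<Rightarrow> ('a \<times> bool) pair_pre_digraph" where
  "corona_K1 H =
     \<lparr> pverts = pverts H \<times> UNIV,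
       parcs = {((u, False), (v, False)) | u v. (u, v) \<in> parcs H}
             \<union> {((u, False), (u, True)) | u. u \<in> pverts H}
             \<union> {((u, True), (u, False)) | u. u \<in> pverts H} \<rparr>"

end

theory Submission
  imports Defs
begin

text \<open>
  A tree on 2m vertices with domination number m is a corona \<^term>\<open>corona_K1\<close> of a
  tree H on m vertices: deleting a non-pendant edge leaves two parts, each dominated by the
  smaller of its two parity classes, so both parts are even; since the neighbours of a vertex v
  split the other 2m - 1 vertices, v is a leaf or has a leaf neighbour, and counting leaves
  against the dominating set of non-leaves makes this neighbour unique. For such a corona the
  eccentric distance sum is an increasing function of the sums over H of the eccentricities, of
  the distance sums and of their products. All three are largest for the path, by induction: if H
  has m + 1 vertices and is not a path, it has a leaf w off a diametral path, whose removal
  changes no other eccentricity; as the diameter is at most m - 1 and the distance sum of w at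
  most m(m + 1)/2, crude estimates of the loss already stay below the corresponding increments for
  paths.
\<close>

section \<open>Metrics of connected graphs and of trees\<close>

text \<open>The distance of a finite connected graph, axiomatised: adjacency is distance 1 and
  \<open>step\<close> is the first edge of a geodesic. A subset of \<open>V\<close> is studied with
  the same \<open>d\<close>, so deleting leaves needs no new graph.\<close>

locale graph_metric =
  fixes V :: "'a set" and d :: "'a \<Rightarrow> 'a \<Rightarrow> nat"
  assumes fin: "finite V" and ne: "V \<noteq> {}"
    and zero_iff: "\<lbrakk>x \<in> V; y \<in> V\<rbrakk> \<Longrightarrow> d x y = 0 \<longleftrightarrow> x = y"
    and sym: "\<lbrakk>x \<in> V; y \<in> V\<rbrakk> \<Longrightarrow> d x y = d y x"
    and tri: "\<lbrakk>x \<in> V; y \<in> V; z \<in> V\<rbrakk> \<Longrightarrow> d x z \<le> d x y + d y z"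
    and step: "\<lbrakk>x \<in> V; y \<in> V; x \<noteq> y\<rbrakk> \<Longrightarrow> \<exists>z\<in>V. d x z = 1 \<and> d x y = Suc (d z y)"

definition ecc_on :: "'a set \<Rightarrow> ('a \<Rightarrow> 'a \<Rightarrow> nat) \<Rightarrow> 'a \<Rightarrow> nat" where
  "ecc_on V d v = Max (d v ` V)"

definition dsum_on :: "'a set \<Rightarrow> ('a \<Rightarrow> 'a \<Rightarrow> nat) \<Rightarrow> 'a \<Rightarrow> nat" where
  "dsum_on V d v = (\<Sum>u\<in>V. d v u)"

definition eds_on :: "'a set \<Rightarrow> ('a \<Rightarrow> 'a \<Rightarrow> nat) \<Rightarrow> nat" where
  "eds_on V d = (\<Sum>v\<in>V. ecc_on V d v * dsum_on V d v)"

context graph_metric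
begin

lemma refl [simp]: "x \<in> V \<Longrightarrow> d x x = 0"
  by (simp add: zero_iff)

lemma adjacent_neq: "\<lbrakk>x \<in> V; y \<in> V; d x y = 1\<rbrakk> \<Longrightarrow> x \<noteq> y"
  by (metis refl zero_neq_one)

lemma ecc_ge: "\<lbrakk>v \<in> V; u \<in> V\<rbrakk> \<Longrightarrow> d v u \<le> ecc_on V d v"
  unfolding ecc_on_def using fin by simp

lemma ecc_attained: "\<exists>u\<in>V. ecc_on V d v = d v u"
  unfolding ecc_on_def using Max_in[of "d v ` V"] fin ne by (auto simp: image_iff)

lemma ecc_eqI: "\<lbrakk>\<And>u. u \<in> V \<Longrightarrow> d v u \<le> k; \<exists>u\<in>V. d v u = k\<rbrakk> \<Longrightarrow> ecc_on V d v = k"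
  unfolding ecc_on_def using fin by (intro Max_eqI) auto

lemma vertex_between:
  assumes "x \<in> V" "y \<in> V" "k \<le> d x y"
  shows "\<exists>z\<in>V. d x z = k \<and> d x z + d z y = d x y"
  using assms(3)
proof (induction k)
  case 0
  then show ?case using assms by force
next
  case (Suc k)
  then obtain z where z: "z \<in> V" "d x z = k" "d x z + d z y = d x y" by auto
  with Suc.prems have "z \<noteq> y" by auto
  then obtain u where u: "u \<in> V" "d z u = 1" "d z y = Suc (d u y)"
    using step z assms by blast
  with z assms tri[of x z u] tri[of x u y] show ?case
    by (intro bexI[of _ u]) auto
qed

text \<open>The vertices \<open>g k\<close> are picked level by level, so consecutive ones need not
  be adjacent. Distinct levels make them distinct, which gives \<open>V\<close> at least
  \<open>d x y + 1\<close> elements.\<close>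

lemma injective_spread:
  assumes "x \<in> V" "y \<in> V"
  obtains g where "g ` {..d x y} \<subseteq> V" "inj_on g {..d x y}"
    "\<And>k. k \<le> d x y \<Longrightarrow> d x (g k) = k \<and> d x (g k) + d (g k) y = d x y"
proof -
  have "\<forall>k. \<exists>z. k \<le> d x y \<longrightarrow> z \<in> V \<and> d x z = k \<and> d x z + d z y = d x y"
    using vertex_between[OF assms] by blast
  then obtain g where g: "\<And>k. k \<le> d x y \<Longrightarrow> g k \<in> V \<and> d x (g k) = k \<and> d x (g k) + d (g k) y = d x y"
    by metis
  show ?thesis
  proof (rule that[of g])
    show "inj_on g {..d x y}" by (rule inj_onI) (metis atMost_iff g)
  qed (use g in blast)+
qed

text \<open>With \<open>e\<close> the eccentricity of \<open>w\<close>, one vertex on each level up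
  to \<open>e\<close> contributes \<open>e * (e + 1) div 2\<close> in total, and the other
  \<open>t\<close> vertices at most \<open>e\<close> each. An end of a path is the worst
  case.\<close>

lemma dsum_le:
  assumes "w \<in> V"
  shows "2 * dsum_on V d w \<le> card V * (card V - 1)"
proof -
  obtain z where z: "z \<in> V" "ecc_on V d w = d w z" using ecc_attained by blast
  define e where "e = d w z"
  obtain g where g: "g ` {..e} \<subseteq> V" "inj_on g {..e}" "\<And>k. k \<le> e \<Longrightarrow> d w (g k) = k"
    using injective_spread[OF assms z(1)] unfolding e_def by metis
  have fg: "finite (g ` {..e})" by simp
  have cg: "card (g ` {..e}) = Suc e" using g(2) by (simp add: card_image)
  obtain t where t: "card V = Suc e + t"
    using card_mono[OF fin g(1)] cg by (metis le_Suc_ex)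
  have "dsum_on V d w = (\<Sum>u\<in>g ` {..e}. d w u) + (\<Sum>u\<in>V - g ` {..e}. d w u)"
    unfolding dsum_on_def using sum.subset_diff[OF g(1) fin, of "d w"] by simp
  also have "(\<Sum>u\<in>g ` {..e}. d w u) = (\<Sum>k\<le>e. k)"
    using g by (simp add: sum.reindex)
  also have "(\<Sum>u\<in>V - g ` {..e}. d w u) \<le> (\<Sum>u\<in>V - g ` {..e}. e)"
    by (rule sum_mono) (use ecc_ge assms z e_def in force)
  also have "\<dots> = t * e"
    using card_Diff_subset[OF fg g(1)] cg t by simp
  finally have "2 * dsum_on V d w \<le> 2 * (\<Sum>k\<le>e. k) + 2 * t * e" by simp
  also have "2 * (\<Sum>k\<le>e. k) = e * Suc e"
    using gauss_sum_nat[of e] by (simp add: atLeast0AtMost)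
  \<comment> \<open>The right side exceeds the left by \<open>t * (t + 1)\<close>.\<close>
  also have "e * Suc e + 2 * t * e \<le> card V * (card V - 1)"
    unfolding t by (simp add: algebra_simps)
  finally show ?thesis by simp
qed

end

text \<open>
  Acyclicity in metric form: for every root r, a vertex v has at most one neighbour that is not
  farther from r than v, namely its parent.
\<close>

locale tree_metric = graph_metric +
  assumes parent_unique: "\<lbrakk>r \<in> V; v \<in> V; x \<in> V; y \<in> V; d v x = 1; d v y = 1;
    d r x \<le> d r v; d r y \<le> d r v\<rbrakk> \<Longrightarrow> x = y"
begin

text \<open>A neighbour on the same level would have to coincide with the parent, which is one level
  lower: a tree is bipartite.\<close>

lemma adjacent_levels_differ:
  assumes "r \<in> V" "v \<in> V" "y \<in> V" "d v y = 1"
  shows "d r v \<noteq> d r y"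
proof
  assume eq: "d r v = d r y"
  show False
  proof (cases "v = r")
    case True
    then show ?thesis using eq assms zero_iff by fastforce
  next
    case False
    then obtain x where x: "x \<in> V" "d v x = 1" "d v r = Suc (d x r)"
      using step assms by blast
    then have "d r v = Suc (d r x)" using sym assms by metis
    with parent_unique[of r v x y] x assms eq show False by simp
  qed
qed

text \<open>A geodesic from \<open>w\<close> to \<open>x\<close> starts with the parent
  \<open>p\<close> or with a child \<open>z\<close>. In the latter case \<open>w\<close> is the
  parent of \<open>z\<close>, and induction gives \<open>d z x = Suc (d w x)\<close>, so the step to
  \<open>z\<close> did not approach \<open>x\<close>.\<close>

lemma dist_via_parent:
  assumes "r \<in> V" "w \<in> V" "x \<in> V" "p \<in> V" "x \<noteq> w" "d r x \<le> d r w" "d w p = 1" "d r p < d r w"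
  shows "d w x = Suc (d p x)"
  using assms(2,4-)
proof (induction "d w x" arbitrary: w p rule: less_induct)
  case less
  obtain z where z: "z \<in> V" "d w z = 1" "d w x = Suc (d z x)"
    using step less.prems assms(3) by blast
  show ?case
  proof (cases "d r z \<le> d r w")
    case True
    then have "z = p" using parent_unique[of r w z p] z less.prems assms(1) by auto
    then show ?thesis using z by simp
  next
    case False
    have "d z x = Suc (d w x)"
      by (rule less.hyps) (use z False less.prems sym in auto)
    then show ?thesis using z by simp
  qed
qed

text \<open>
  Replacing the point farthest from a root by its parent lowers all three distance sums by one.
\<close>

theorem four_point:
  assumes "x \<in> V" "y \<in> V" "z \<in> V" "w \<in> V"
  shows "d x y + d z w \<le> max (d x z + d y w) (d x w + d y z)"
proof -
  obtain r where r: "r \<in> V" using ne by blast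
  show ?thesis
    using assms
  proof (induction "d r x + d r y + d r z + d r w" arbitrary: x y z w rule: less_induct)
    case less
    \<comment> \<open>It suffices to treat the case where the first point is farthest from
      \<open>r\<close>: the claim is invariant under permutations that bring any of the four points
      to the front.\<close>
    have key: "d x' y' + d z' w' \<le> max (d x' z' + d y' w') (d x' w' + d y' z')"
      if V: "x' \<in> V" "y' \<in> V" "z' \<in> V" "w' \<in> V"
        and s: "d r x' + d r y' + d r z' + d r w' = d r x + d r y + d r z + d r w"
        and m: "d r y' \<le> d r x'" "d r z' \<le> d r x'" "d r w' \<le> d r x'" for x' y' z' w'
    proof (cases "x' \<in> {y', z', w'}")
      case True
      then show ?thesis using V tri sym refl
        by (smt (verit) add_0 insertE max.cobounded1 max.cobounded2 empty_iff le_trans add.commute)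
    next
      case False
      \<comment> \<open>If \<open>x'\<close> were \<open>r\<close>, then \<open>y'\<close> would
        have level 0 as well and equal \<open>x'\<close>.\<close>
      then have "x' \<noteq> r" using m(1) V r zero_iff by (metis insertI1 le_zero_eq)
      then obtain p where p: "p \<in> V" "d x' p = 1" "d x' r = Suc (d p r)"
        using step V r by blast
      then have lt: "d r p < d r x'" using sym V r by (metis lessI)
      have "d p y' + d z' w' \<le> max (d p z' + d y' w') (d p w' + d y' z')"
        by (rule less.hyps) (use V p lt s in auto)
      moreover have "d x' u = Suc (d p u)" if "u \<in> {y', z', w'}" for u
        by (rule dist_via_parent[of r]) (use that V p lt m r False in auto)
      ultimately show ?thesis by simp
    qed
    have c: "\<And>u v. u \<in> {x,y,z,w} \<Longrightarrow> v \<in> {x,y,z,w} \<Longrightarrow> d u v = d v u"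
      using less.prems sym by blast
    consider "d r y \<le> d r x" "d r z \<le> d r x" "d r w \<le> d r x"
      | "d r x \<le> d r y" "d r z \<le> d r y" "d r w \<le> d r y"
      | "d r x \<le> d r z" "d r y \<le> d r z" "d r w \<le> d r z"
      | "d r x \<le> d r w" "d r y \<le> d r w" "d r z \<le> d r w"
      by linarith
    then show ?case
    proof cases
      case 1
      then show ?thesis using key[of x y z w] less.prems by simp
    next
      case 2
      then show ?thesis using key[of y x z w] less.prems c[of y x] by (simp add: max.commute add.commute)
    next
      case 3
      then show ?thesis using key[of z w x y] less.prems c[of z x] c[of z y] c[of w x] c[of w y]
        by (simp add: max.commute add.commute)
    next
      case 4
      then show ?thesis using key[of w z x y] less.prems c[of z x] c[of z y] c[of w x] c[of w y] c[of w z]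
        by (simp add: max.commute add.commute)
    qed
  qed
qed

end

section \<open>Diametral pairs, geodesics and leaves of a tree metric\<close>

context tree_metric
begin

text \<open>In the four-point inequality for \<open>v\<close>, \<open>u\<close>, \<open>p\<close>,
  \<open>q\<close>, both \<open>d u p\<close> and \<open>d u q\<close> are at most
  \<open>d p q\<close>; cancelling bounds \<open>d v u\<close>. So every eccentricity is attained at
  an end of a diametral pair.\<close>

lemma ecc_diametral:
  assumes p: "p \<in> V" and q: "q \<in> V" and v: "v \<in> V"
    and diam: "\<And>x y. \<lbrakk>x \<in> V; y \<in> V\<rbrakk> \<Longrightarrow> d x y \<le> d p q"
  shows "ecc_on V d v = max (d v p) (d v q)"
proof (rule ecc_eqI)
  fix u assume u: "u \<in> V"
  show "d v u \<le> max (d v p) (d v q)"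
    using four_point[OF v u p q] diam[OF u p] diam[OF u q] by auto
qed (use p q in \<open>auto simp: max_def\<close>)

text \<open>The upper bound is the four-point inequality for \<open>x\<close>, \<open>y\<close>,
  \<open>p\<close>, \<open>q\<close>, the lower one the triangle inequality. Thus \<open>d p\<close>
  reads off positions on a path.\<close>

lemma diametral_path_isometric:
  assumes p: "p \<in> V" and q: "q \<in> V"
    and P: "\<And>v. v \<in> V \<Longrightarrow> d p v + d v q = d p q"
    and x: "x \<in> V" and y: "y \<in> V" and le: "d p x \<le> d p y"
  shows "d x y = d p y - d p x"
proof -
  have "d x y + d p q \<le> max (d x p + d y q) (d x q + d y p)"
    using four_point[OF x y p q] .
  moreover have "d x p = d p x" "d y p = d p y" using sym p x y by auto
  ultimately have "d x y \<le> d p y - d p x" using P[OF x] P[OF y] le by linarith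
  moreover have "d p y \<le> d p x + d x y" using tri p x y by blast
  ultimately show ?thesis by linarith
qed

text \<open>\<open>leaf\<close> is the metric form of being a leaf: no geodesic between other
  vertices passes through \<open>w\<close>. Hence the geodesics among the remaining vertices
  survive.\<close>

lemma remove_leaf:
  assumes w: "w \<in> V" and ne': "V - {w} \<noteq> {}"
    and leaf: "\<And>u v. \<lbrakk>u \<in> V - {w}; v \<in> V - {w}\<rbrakk> \<Longrightarrow> d u v < d u w + d w v"
  shows "tree_metric (V - {w}) d"
proof
  fix x y assume x: "x \<in> V - {w}" and y: "y \<in> V - {w}" and "x \<noteq> y"
  then obtain z where z: "z \<in> V" "d x z = 1" "d x y = Suc (d z y)" using step by blast
  moreover have "z \<noteq> w" using z leaf[OF x y] by auto
  ultimately show "\<exists>z\<in>V - {w}. d x z = 1 \<and> d x y = Suc (d z y)" by blast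
next
  fix r v x y
  assume "r \<in> V - {w}" "v \<in> V - {w}" "x \<in> V - {w}" "y \<in> V - {w}"
    "d v x = 1" "d v y = 1" "d r x \<le> d r v" "d r y \<le> d r v"
  then show "x = y" using parent_unique by (meson DiffD1)
qed (use fin ne' zero_iff sym tri in auto)

text \<open>The witness is a vertex farthest from \<open>p\<close> among those on no geodesic from
  \<open>p\<close> to \<open>q\<close>.\<close>

lemma leaf_off_geodesic:
  assumes p: "p \<in> V" and q: "q \<in> V" and v: "v \<in> V" "d p v + d v q \<noteq> d p q"
  obtains w where "w \<in> V" "d p w + d w q \<noteq> d p q"
    "\<And>u v. \<lbrakk>u \<in> V - {w}; v \<in> V - {w}\<rbrakk> \<Longrightarrow> d u v < d u w + d w v"
proof -
  define N where "N = {v\<in>V. d p v + d v q \<noteq> d p q}"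
  have N: "finite N" "N \<noteq> {}" using fin v by (auto simp: N_def)
  obtain w where w: "w \<in> N" "\<And>u. u \<in> N \<Longrightarrow> d p u \<le> d p w"
  proof -
    have "Max (d p ` N) \<in> d p ` N" using N by simp
    then obtain w where "w \<in> N" "d p w = Max (d p ` N)" by auto
    then show thesis using that[of w] N by simp
  qed
  have wV: "w \<in> V" using w(1) by (simp add: N_def)
  \<comment> \<open>A vertex \<open>x\<close> behind \<open>w\<close> as seen from \<open>p\<close>
    is farther from \<open>p\<close> than \<open>w\<close>, hence on a geodesic from
    \<open>p\<close> to \<open>q\<close>; this would put \<open>w\<close> on one too.\<close>
  have down: False if x: "x \<in> V" "x \<noteq> w" and le: "d w x + d p w \<le> d p x" for x
  proof -
    have "d w x \<noteq> 0" using x wV zero_iff by auto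
    then have "x \<notin> N" using w(2)[of x] le by auto
    then have "d p x + d x q = d p q" using x by (simp add: N_def)
    moreover have "d w q \<le> d w x + d x q" "d p q \<le> d p w + d w q" using tri p q x wV by auto
    ultimately have "d p w + d w q = d p q" using le by linarith
    then show False using w(1) by (simp add: N_def)
  qed
  show ?thesis
  proof (rule that[of w])
    fix u v assume u: "u \<in> V - {w}" and v: "v \<in> V - {w}"
    show "d u v < d u w + d w v"
    proof (rule ccontr)
      assume "\<not> d u v < d u w + d w v"
      \<comment> \<open>If \<open>w\<close> lies between \<open>u\<close> and \<open>v\<close>, the
        four-point inequality places one of them behind \<open>w\<close> as seen from
        \<open>p\<close>.\<close>
      moreover have "d u v + d w p \<le> max (d u w + d v p) (d u p + d v w)"
        using four_point[of u v w p] u v wV p by blast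
      moreover have "d u w = d w u" "d v w = d w v" "d w p = d p w" "d v p = d p v" "d u p = d p u"
        using sym u v wV p by auto
      ultimately have "d w v + d p w \<le> d p v \<or> d w u + d p w \<le> d p u" by linarith
      then show False using down u v by blast
    qed
  qed (use w(1) N_def in auto)
qed

end

section \<open>Path sums and extremality of the path\<close>

text \<open>The absolute difference, since at least one of the two truncated subtractions is
  0.\<close>

definition path_dist :: "nat \<Rightarrow> nat \<Rightarrow> nat" where
  "path_dist i j = (i - j) + (j - i)"

definition ecc_total :: "'a set \<Rightarrow> ('a \<Rightarrow> 'a \<Rightarrow> nat) \<Rightarrow> nat" where
  "ecc_total V d = (\<Sum>v\<in>V. ecc_on V d v)"

definition dsum_total :: "'a set \<Rightarrow> ('a \<Rightarrow> 'a \<Rightarrow> nat) \<Rightarrow> nat" where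
  "dsum_total V d = (\<Sum>v\<in>V. dsum_on V d v)"

lemma ecc_on_path: "i < m \<Longrightarrow> ecc_on {..<m} path_dist i = max i (m - 1 - i)"
  unfolding ecc_on_def path_dist_def
proof (rule Max_eqI)
  assume i: "i < m"
  show "max i (m - 1 - i) \<in> (\<lambda>j. i - j + (j - i)) ` {..<m}"
  proof (cases "i \<le> m - 1 - i")
    case True
    then show ?thesis using i by (intro image_eqI[of _ _ "m - 1"]) auto
  next
    case False
    then show ?thesis using i by (intro image_eqI[of _ _ 0]) auto
  qed
qed auto

lemma dsum_on_path_end: "2 * dsum_on {..<Suc m} path_dist m = m * Suc m"
proof -
  have "dsum_on {..<Suc m} path_dist m = (\<Sum>j<Suc m. m - j)"
    unfolding dsum_on_def path_dist_def by (rule sum.cong) auto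
  also have "\<dots> = (\<Sum>j<Suc m. j)"
    using sum.nat_diff_reindex[of "\<lambda>j. j" "Suc m"] by simp
  finally show ?thesis using gauss_sum_nat[of m]
    by (simp add: atLeast0AtMost lessThan_Suc_atMost)
qed

lemma dsum_on_path_Suc: "i < m \<Longrightarrow> dsum_on {..<Suc m} path_dist i = dsum_on {..<m} path_dist i + (m - i)"
  by (simp add: dsum_on_def path_dist_def)

lemma dsum_on_path: "i < m \<Longrightarrow> 2 * dsum_on {..<m} path_dist i = i * (i + 1) + (m - 1 - i) * (m - i)"
proof (induction m)
  case (Suc m)
  show ?case
  proof (cases "i = m")
    case True
    then show ?thesis using dsum_on_path_end[of m] by simp
  next
    case False
    then have "i < m" using Suc.prems by simp
    then obtain t where t: "m = Suc (i + t)" by (metis less_iff_Suc_add)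
    show ?thesis using Suc.IH dsum_on_path_Suc[of i m] \<open>i < m\<close> unfolding t
      by (simp add: algebra_simps)
  qed
qed simp

text \<open>Appending a vertex to a path lowers no eccentricity, and the new end has eccentricity
  \<open>m\<close>. This increment, like those of the two other totals, is what a removed leaf is
  measured against in \<open>totals_le_path\<close>.\<close>

lemma ecc_total_path_Suc: "ecc_total {..<m} path_dist + m \<le> ecc_total {..<Suc m} path_dist"
proof -
  have "ecc_total {..<m} path_dist \<le> (\<Sum>i<m. ecc_on {..<Suc m} path_dist i)"
    unfolding ecc_total_def by (rule sum_mono) (auto simp: ecc_on_path)
  then show ?thesis by (simp add: ecc_total_def ecc_on_path)
qed

lemma dsum_total_path_Suc: "dsum_total {..<Suc m} path_dist = dsum_total {..<m} path_dist + m * Suc m"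
proof -
  have "(\<Sum>i<m. m - i) = dsum_on {..<Suc m} path_dist m"
    unfolding dsum_on_def by (simp add: path_dist_def)
  then have "2 * (\<Sum>i<m. m - i) = m * Suc m" using dsum_on_path_end by simp
  moreover have "(\<Sum>i<m. dsum_on {..<Suc m} path_dist i) = dsum_total {..<m} path_dist + (\<Sum>i<m. m - i)"
    unfolding dsum_total_def sum.distrib[symmetric] by (rule sum.cong) (auto simp: dsum_on_path_Suc)
  ultimately show ?thesis
    using dsum_on_path_end[of m] by (simp add: dsum_total_def)
qed

section \<open>Closed form of the eccentric distance sum of the path, by folding it at its
  middle\<close>

lemma sum_reflect:
  fixes g :: "nat \<Rightarrow> 'b::comm_semiring_1"
  assumes "\<And>i. i < k \<Longrightarrow> g (n + k - 1 - i) = g i"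
  shows "(\<Sum>i<n + k. g i) = (\<Sum>i<n. g i) + (\<Sum>i<k. g i)"
proof -
  have "(\<Sum>i<n + k. g i) = (\<Sum>i<n. g i) + (\<Sum>i=n..<n + k. g i)"
    by (metis atLeast0LessThan le_add1 sum.atLeastLessThan_concat zero_le)
  also have "(\<Sum>i=n..<n + k. g i) = (\<Sum>i<k. g i)"
  proof (rule sum.reindex_bij_witness[of _ "\<lambda>i. n + k - 1 - i" "\<lambda>i. n + k - 1 - i"])
    fix a assume "a \<in> {n..<n + k}"
    then show "g (n + k - 1 - a) = g a" using assms[of "n + k - 1 - a"] by auto
  qed auto
  finally show ?thesis .
qed

text \<open>
  For a = m - 1 and i below the middle, the summand is twice the product of the eccentricity and
  the distance sum of the i-th vertex of the path on m vertices.
\<close>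

lemma sum_half_path:
  fixes a :: int
  shows "6 * (\<Sum>i<n. (a - int i) * (int i * (int i + 1) + (a - int i) * (a + 1 - int i))) =
    6 * (a^3 + a^2) * int n - 3 * (3 * a^2 + a) * int n * (int n - 1)
    + 4 * a * int n * (int n - 1) * (2 * int n - 1) - 3 * (int n)^2 * (int n - 1)^2"
  by (induction n) (simp_all add: algebra_simps power2_eq_square power3_eq_cube)

text \<open>\<open>2 * i < m\<close> makes \<open>m - 1\<close> the end farther from
  \<open>i\<close>. The unsimplified \<open>int m - 1 + 1\<close> is the \<open>a + 1\<close> of
  \<open>sum_half_path\<close> at \<open>a = int m - 1\<close>.\<close>

lemma eds_path_summand:
  assumes "i < m" "2 * i < m"
  shows "2 * int (ecc_on {..<m} path_dist i * dsum_on {..<m} path_dist i) =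
    (int m - 1 - int i) * (int i * (int i + 1) + (int m - 1 - int i) * (int m - 1 + 1 - int i))"
proof -
  have "ecc_on {..<m} path_dist i = m - 1 - i" using assms ecc_on_path[of i m] by simp
  moreover obtain t where t: "m = Suc (i + t)" using assms(1) by (metis less_iff_Suc_add)
  moreover have "2 * int (dsum_on {..<m} path_dist i) = int (i * (i + 1) + (m - 1 - i) * (m - i))"
    using dsum_on_path[OF assms(1)] by linarith
  ultimately show ?thesis by (simp add: algebra_simps)
qed

lemma eds_path_symmetric:
  assumes "i < m"
  shows "ecc_on {..<m} path_dist (m - 1 - i) * dsum_on {..<m} path_dist (m - 1 - i) =
    ecc_on {..<m} path_dist i * dsum_on {..<m} path_dist i"
proof -
  obtain t where t: "m = Suc (i + t)" using assms by (metis less_iff_Suc_add)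
  have "2 * dsum_on {..<m} path_dist (m - 1 - i) = 2 * dsum_on {..<m} path_dist i"
    using dsum_on_path[of i m] dsum_on_path[of "m - 1 - i" m] unfolding t by simp
  moreover have "ecc_on {..<m} path_dist (m - 1 - i) = ecc_on {..<m} path_dist i"
    using ecc_on_path[of i m] ecc_on_path[of "m - 1 - i" m] unfolding t by (simp add: max.commute)
  ultimately show ?thesis by simp
qed

text \<open>\<open>n\<close> and \<open>k\<close> are the two halves of \<open>m\<close>, rounded up
  and down, so a middle vertex is counted once. For \<open>i < n\<close> one has
  \<open>2 * i \<le> (n - 1) + k < m\<close>, so \<open>eds_path_summand\<close> covers both
  ranges.\<close>

lemma eds_on_path_split:
  assumes "m = n + k" "k \<le> n" "n \<le> Suc k"
  shows "2 * int (eds_on {..<m} path_dist) =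
    (\<Sum>i<n. (int m - 1 - int i) * (int i * (int i + 1) + (int m - 1 - int i) * (int m - 1 + 1 - int i))) +
    (\<Sum>i<k. (int m - 1 - int i) * (int i * (int i + 1) + (int m - 1 - int i) * (int m - 1 + 1 - int i)))"
proof -
  let ?g = "\<lambda>i. ecc_on {..<m} path_dist i * dsum_on {..<m} path_dist i"
  have "eds_on {..<m} path_dist = (\<Sum>i<n. ?g i) + (\<Sum>i<k. ?g i)"
    unfolding eds_on_def using sum_reflect[of k ?g n] eds_path_symmetric[of _ m] assms by simp
  then have "2 * int (eds_on {..<m} path_dist) = (\<Sum>i<n. 2 * int (?g i)) + (\<Sum>i<k. 2 * int (?g i))"
    by (simp add: sum_distrib_left)
  also have "(\<Sum>i<n. 2 * int (?g i)) =
      (\<Sum>i<n. (int m - 1 - int i) * (int i * (int i + 1) + (int m - 1 - int i) * (int m - 1 + 1 - int i)))"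
    by (rule sum.cong[OF refl], rule eds_path_summand) (use assms in auto)
  also have "(\<Sum>i<k. 2 * int (?g i)) =
      (\<Sum>i<k. (int m - 1 - int i) * (int i * (int i + 1) + (int m - 1 - int i) * (int m - 1 + 1 - int i)))"
    by (rule sum.cong[OF refl], rule eds_path_summand) (use assms in auto)
  finally show ?thesis .
qed

lemma eds_on_path_even:
  "6 * int (eds_on {..<2 * k} path_dist) = 25 * int k ^ 4 - 8 * int k ^ 3 - 7 * int k ^ 2 + 2 * int k"
  using eds_on_path_split[of "2 * k" k k] sum_half_path[of "2 * int k - 1" k]
  by (simp add: algebra_simps power2_eq_square power3_eq_cube power_numeral_reduce)

lemma eds_on_path_odd:
  "6 * int (eds_on {..<Suc (2 * k)} path_dist) = 25 * int k ^ 4 + 42 * int k ^ 3 + 17 * int k ^ 2"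
  using eds_on_path_split[of "Suc (2 * k)" "Suc k" k] sum_half_path[of "2 * int k" k]
    sum_half_path[of "2 * int k" "Suc k"]
  by (simp add: algebra_simps power2_eq_square power3_eq_cube power_numeral_reduce)

text \<open>\<open>(m - 1) * m * Suc m\<close> is the bound for the contribution of a removed leaf
  in \<open>totals_le_path\<close>. With \<open>k = m div 2\<close>, six times the difference of the
  two sides is \<open>2 * k^3 + 24 * k^2 + 10 * k\<close> for even \<open>m\<close> and
  \<open>2 * k^3 + 30 * k^2 + 40 * k + 12\<close> for odd \<open>m\<close>.\<close>

lemma eds_on_path_Suc:
  "eds_on {..<m} path_dist + (m - 1) * m * Suc m \<le> eds_on {..<Suc m} path_dist"
proof (cases "even m")
  case True
  then obtain k where k: "m = 2 * k" by blast
  show ?thesis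
  proof (cases k)
    \<comment> \<open>Writing \<open>k\<close> as a successor turns the truncated
      \<open>m - 1\<close> into a genuine subtraction.\<close>
    case (Suc j)
    have "6 * int (eds_on {..<m} path_dist + (m - 1) * m * Suc m) \<le> 6 * int (eds_on {..<Suc m} path_dist)"
      using eds_on_path_even[of k] eds_on_path_odd[of k] unfolding k Suc
      by (simp add: algebra_simps power2_eq_square power3_eq_cube power_numeral_reduce)
    then show ?thesis by (metis mult_le_cancel_left_pos of_nat_le_iff zero_less_numeral)
  qed (simp add: k eds_on_def)
next
  case False
  then obtain k where k: "m = Suc (2 * k)" by (metis oddE Suc_eq_plus1)
  have "6 * int (eds_on {..<m} path_dist + (m - 1) * m * Suc m) \<le> 6 * int (eds_on {..<Suc m} path_dist)"
    using eds_on_path_even[of "Suc k"] eds_on_path_odd[of k] unfolding k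
    by (simp add: algebra_simps power2_eq_square power3_eq_cube power_numeral_reduce)
  then show ?thesis by (metis mult_le_cancel_left_pos of_nat_le_iff zero_less_numeral)
qed

section \<open>Removal of a leaf and comparison with the path\<close>

context graph_metric
begin

lemma dsum_on_remove:
  "w \<in> V \<Longrightarrow> dsum_on V d v = dsum_on (V - {w}) d v + d v w"
  unfolding dsum_on_def using fin by (simp add: sum.remove)

lemma sum_dist_to: "w \<in> V \<Longrightarrow> (\<Sum>v\<in>V - {w}. d v w) = dsum_on V d w"
  unfolding dsum_on_def using fin sym by (subst sum.remove[of V w]) (auto intro!: sum.cong)

text \<open>Each distance to \<open>w\<close> occurs once in the distance sum of \<open>w\<close>
  and once in that of the other vertex.\<close>

lemma dsum_total_remove:
  assumes w: "w \<in> V"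
  shows "dsum_total V d = dsum_total (V - {w}) d + 2 * dsum_on V d w"
proof -
  have "dsum_total V d = dsum_on V d w + (\<Sum>v\<in>V - {w}. dsum_on V d v)"
    unfolding dsum_total_def using fin w by (simp add: sum.remove)
  also have "(\<Sum>v\<in>V - {w}. dsum_on V d v) = dsum_total (V - {w}) d + dsum_on V d w"
    unfolding dsum_total_def sum_dist_to[OF w, symmetric] sum.distrib[symmetric]
    by (rule sum.cong) (use dsum_on_remove[OF w] in auto)
  finally show ?thesis by simp
qed

lemma totals_isometric:
  assumes f: "bij_betw f V W" and iso: "\<And>x y. \<lbrakk>x \<in> V; y \<in> V\<rbrakk> \<Longrightarrow> d' (f x) (f y) = d x y"
  shows "ecc_total W d' = ecc_total V d" "dsum_total W d' = dsum_total V d" "eds_on W d' = eds_on V d"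
proof -
  have W: "W = f ` V" and inj: "inj_on f V" using f by (auto simp: bij_betw_def)
  have e: "ecc_on W d' (f v) = ecc_on V d v" if "v \<in> V" for v
    unfolding ecc_on_def W image_image by (rule arg_cong[where f = Max], rule image_cong) (use iso that in auto)
  have s: "dsum_on W d' (f v) = dsum_on V d v" if "v \<in> V" for v
    unfolding dsum_on_def W sum.reindex[OF inj] by (rule sum.cong) (use iso that in auto)
  show "ecc_total W d' = ecc_total V d" "dsum_total W d' = dsum_total V d" "eds_on W d' = eds_on V d"
    unfolding ecc_total_def dsum_total_def eds_on_def
    by (subst sum.reindex_bij_betw[OF f, symmetric], rule sum.cong, use e s in auto)+
qed

end

theorem (in tree_metric) totals_le_path:
  "ecc_total V d \<le> ecc_total {..<card V} path_dist \<and>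
   dsum_total V d \<le> dsum_total {..<card V} path_dist \<and>
   eds_on V d \<le> eds_on {..<card V} path_dist"
  using tree_metric_axioms
proof (induction "card V" arbitrary: V)
  case 0
  then interpret tree_metric V d by simp
  show ?case using 0 fin ne by simp
next
  case (Suc m)
  interpret tree_metric V d by fact
  obtain p q where p: "p \<in> V" and q: "q \<in> V"
    and diam: "\<And>x y. \<lbrakk>x \<in> V; y \<in> V\<rbrakk> \<Longrightarrow> d x y \<le> d p q"
  proof -
    let ?D = "(\<lambda>(x, y). d x y) ` (V \<times> V)"
    have "Max ?D \<in> ?D" using fin ne by (intro Max_in) auto
    then obtain p q where "p \<in> V" "q \<in> V" "d p q = Max ?D" by auto
    moreover have "d x y \<le> Max ?D" if "x \<in> V" "y \<in> V" for x y
      using that fin by (intro Max_ge) auto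
    ultimately show thesis using that by metis
  qed
  obtain g where g: "g ` {..d p q} \<subseteq> V" "inj_on g {..d p q}"
    "\<And>k. k \<le> d p q \<Longrightarrow> d p (g k) = k \<and> d p (g k) + d (g k) q = d p q"
    using injective_spread[OF p q] by blast
  show ?case
  proof (cases "\<forall>v\<in>V. d p v + d v q = d p q")
    \<comment> \<open>All vertices lie on geodesics from \<open>p\<close> to \<open>q\<close>, so
      the distance from \<open>p\<close> maps \<open>V\<close> isometrically onto an initial segment
      of the naturals.\<close>
    case True
    have iso: "path_dist (d p x) (d p y) = d x y" if "x \<in> V" "y \<in> V" for x y
      using diametral_path_isometric[OF p q, of x y] diametral_path_isometric[OF p q, of y x] True that sym
      by (cases "d p x \<le> d p y") (auto simp: path_dist_def)
    have inj: "inj_on (d p) V"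
    proof (rule inj_onI)
      fix x y assume "x \<in> V" "y \<in> V" "d p x = d p y"
      then show "x = y" using iso[of x y] zero_iff by (simp add: path_dist_def)
    qed
    have "d p ` V = {..d p q}"
    proof
      show "d p ` V \<subseteq> {..d p q}" using diam p by auto
      show "{..d p q} \<subseteq> d p ` V" using g(1,3) by (metis atMost_iff image_subset_iff image_eqI subsetI)
    qed
    moreover from this have "card V = Suc (d p q)" using card_image[OF inj] by simp
    ultimately have "bij_betw (d p) V {..<card V}"
      using inj by (simp add: bij_betw_def lessThan_Suc_atMost)
    from totals_isometric[OF this, of path_dist] iso show ?thesis by simp
  next
    case False
    then obtain w where w: "w \<in> V" "d p w + d w q \<noteq> d p q"
      and leaf: "\<And>u v. \<lbrakk>u \<in> V - {w}; v \<in> V - {w}\<rbrakk> \<Longrightarrow> d u v < d u w + d w v"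
      using leaf_off_geodesic[OF p q] by metis
    have pq: "p \<in> V - {w}" "q \<in> V - {w}" using w p q by auto
    interpret L: tree_metric "V - {w}" d using remove_leaf[OF w(1) _ leaf] pq by blast
    have m: "card (V - {w}) = m" using Suc.hyps(2) w(1) fin by simp
    \<comment> \<open>The \<open>d p q + 1\<close> vertices \<open>g k\<close> lie on geodesics from
      \<open>p\<close> to \<open>q\<close> and \<open>w\<close> does not, so they are among the
      \<open>m\<close> remaining vertices.\<close>
    have "g ` {..d p q} \<subseteq> V - {w}" using g w(2) by auto
    from card_mono[OF L.fin this] have dm: "Suc (d p q) \<le> m" using g(2) m by (simp add: card_image)
    \<comment> \<open>\<open>p\<close> and \<open>q\<close> survive and remain diametral, so
      \<open>ecc_diametral\<close> gives the same value before and after the removal.\<close>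
    have ecc: "ecc_on V d v = ecc_on (V - {w}) d v" if "v \<in> V - {w}" for v
      using ecc_diametral[OF p q _ diam] L.ecc_diametral[OF pq that] diam that by auto
    have ecc_le: "ecc_on V d v \<le> m - 1" if "v \<in> V" for v
      using ecc_diametral[OF p q that diam] diam[OF that p] diam[OF that q] dm by linarith
    have dsum: "2 * dsum_on V d w \<le> m * Suc m" using dsum_le[OF w(1)] Suc.hyps(2)[symmetric] by (simp add: mult.commute)
    have IH: "ecc_total (V - {w}) d \<le> ecc_total {..<m} path_dist"
      "dsum_total (V - {w}) d \<le> dsum_total {..<m} path_dist"
      "eds_on (V - {w}) d \<le> eds_on {..<m} path_dist"
      using Suc.hyps(1)[OF m[symmetric]] L.tree_metric_axioms m by auto
    have "ecc_total V d = ecc_total (V - {w}) d + ecc_on V d w"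
      unfolding ecc_total_def using fin w(1) ecc by (simp add: sum.remove)
    then have 1: "ecc_total V d \<le> ecc_total {..<Suc m} path_dist"
      using IH(1) ecc_total_path_Suc[of m] ecc_le[OF w(1)] by linarith
    have 2: "dsum_total V d \<le> dsum_total {..<Suc m} path_dist"
      using IH(2) dsum_total_path_Suc[of m] dsum_total_remove[OF w(1)] dsum by linarith
    \<comment> \<open>\<open>w\<close> contributes its own term and its share in the other distance
      sums; as eccentricities are at most \<open>m - 1\<close>, each is at most \<open>m - 1\<close>
      times the distance sum of \<open>w\<close>.\<close>
    have "eds_on V d = ecc_on V d w * dsum_on V d w + (\<Sum>v\<in>V - {w}. ecc_on V d v * dsum_on V d v)"
      unfolding eds_on_def using fin w(1) by (simp add: sum.remove)
    also have "(\<Sum>v\<in>V - {w}. ecc_on V d v * dsum_on V d v) =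
        eds_on (V - {w}) d + (\<Sum>v\<in>V - {w}. ecc_on V d v * d v w)"
      unfolding eds_on_def sum.distrib[symmetric]
      by (rule sum.cong) (auto simp: dsum_on_remove[OF w(1)] ecc algebra_simps)
    also have "(\<Sum>v\<in>V - {w}. ecc_on V d v * d v w) \<le> (\<Sum>v\<in>V - {w}. (m - 1) * d v w)"
      by (intro sum_mono mult_right_mono) (use ecc_le in auto)
    also have "(\<Sum>v\<in>V - {w}. (m - 1) * d v w) = (m - 1) * dsum_on V d w"
      by (simp add: sum_distrib_left[symmetric] sum_dist_to[OF w(1)])
    also have "ecc_on V d w * dsum_on V d w \<le> (m - 1) * dsum_on V d w"
      using ecc_le[OF w(1)] by simp
    finally have "eds_on V d \<le> eds_on (V - {w}) d + (m - 1) * (2 * dsum_on V d w)" by simp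
    also have "\<dots> \<le> eds_on {..<m} path_dist + (m - 1) * (m * Suc m)"
      by (intro add_mono mult_left_mono IH dsum) simp
    also have "\<dots> \<le> eds_on {..<Suc m} path_dist"
      using eds_on_path_Suc[of m] by (simp add: algebra_simps)
    finally show ?thesis using 1 2 Suc.hyps(2) by simp
  qed
qed

section \<open>Coronas\<close>

text \<open>\<open>H\<close> is the core and \<open>l u\<close> the leaf attached to
  \<open>u\<close>. The purely metric form fits both an arbitrary tree of the class and the corona
  of the path.\<close>

locale corona_metric = graph_metric +
  fixes H :: "'a set" and l :: "'a \<Rightarrow> 'a"
  assumes partition: "V = H \<union> l ` H" and disjoint: "H \<inter> l ` H = {}" and inj: "inj_on l H"
    and leaf: "\<lbrakk>u \<in> H; x \<in> V\<rbrakk> \<Longrightarrow> d (l u) x = 1 \<longleftrightarrow> x = u"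
begin

lemma core_in [simp]: "u \<in> H \<Longrightarrow> u \<in> V" and leaf_in [simp]: "u \<in> H \<Longrightarrow> l u \<in> V"
  using partition by auto

lemma fin_core: "finite H"
  using fin partition by simp

lemma card_corona: "card V = 2 * card H"
  using card_Un_disjoint[of H "l ` H"] fin_core disjoint inj by (simp add: partition[symmetric] card_image)

lemma sum_corona: "(\<Sum>x\<in>V. f x) = (\<Sum>x\<in>H. f x) + (\<Sum>x\<in>H. f (l x))"
  using sum.union_disjoint[of H "l ` H" f] fin_core disjoint
  by (simp add: partition[symmetric] sum.reindex[OF inj])

lemma leaf_dist: "\<lbrakk>u \<in> H; x \<in> V; x \<noteq> l u\<rbrakk> \<Longrightarrow> d (l u) x = Suc (d u x)"
  using step[of "l u" x] leaf[of u] by auto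

lemma core_leaf_dist: "\<lbrakk>u \<in> H; x \<in> H\<rbrakk> \<Longrightarrow> d x (l u) = Suc (d x u)"
  using leaf_dist[of u x] sym[of x "l u"] sym[of x u] disjoint by fastforce

lemma leaves_dist: "\<lbrakk>u \<in> H; x \<in> H; x \<noteq> u\<rbrakk> \<Longrightarrow> d (l u) (l x) = d u x + 2"
  using leaf_dist[of u "l x"] core_leaf_dist[of x u] inj by (auto simp: inj_on_eq_iff)

text \<open>A geodesic between core vertices avoids leaves: a leaf can only be entered from its core
  vertex and left back to it.\<close>

lemma core_graph_metric: "graph_metric H d"
proof
  show "H \<noteq> {}" using ne partition by auto
  fix x y assume x: "x \<in> H" and y: "y \<in> H" and "x \<noteq> y"
  then obtain z where z: "z \<in> V" "d x z = 1" "d x y = Suc (d z y)" using step by force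
  have "z \<in> H"
  proof (rule ccontr)
    assume "z \<notin> H"
    then obtain u where u: "u \<in> H" "z = l u" using z(1) partition by auto
    then have "x = u" using leaf[of u x] sym[of "l u" x] z x by simp
    then show False using leaf_dist[of u y] u y z disjoint by fastforce
  qed
  then show "\<exists>z\<in>H. d x z = 1 \<and> d x y = Suc (d z y)" using z by blast
qed (use fin_core zero_iff sym tri in auto)

sublocale core: graph_metric H d
  by (rule core_graph_metric)

lemma dsum_core: "u \<in> H \<Longrightarrow> dsum_on V d u = 2 * dsum_on H d u + card H"
  unfolding dsum_on_def sum_corona by (simp add: core_leaf_dist sum_Suc)

text \<open>Each of the \<open>2 * card H - 1\<close> vertices other than \<open>l u\<close> is one
  farther from \<open>l u\<close> than from \<open>u\<close>. The term \<open>d u (l u) = 1\<close>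
  drops out of the sum for \<open>u\<close>, which leaves
  \<open>(card H - 1) + (2 * card H - 1)\<close> as the constant.\<close>

lemma dsum_leaf:
  assumes "u \<in> H"
  shows "dsum_on V d (l u) = 2 * dsum_on H d u + (3 * card H - 2)"
proof -
  have pos: "card H > 0" using assms fin_core card_gt_0_iff by blast
  have "dsum_on V d (l u) = (\<Sum>x\<in>V - {l u}. d (l u) x)"
    unfolding dsum_on_def using assms fin by (simp add: sum.remove[of V "l u"])
  also have "\<dots> = (\<Sum>x\<in>V - {l u}. Suc (d u x))"
    using assms by (intro sum.cong) (auto simp: leaf_dist)
  also have "\<dots> = (\<Sum>x\<in>V - {l u}. d u x) + (2 * card H - 1)"
    using assms by (simp add: sum_Suc card_corona)
  finally have "dsum_on V d (l u) = (\<Sum>x\<in>V - {l u}. d u x) + (2 * card H - 1)" .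
  moreover have "(\<Sum>x\<in>V - {l u}. d u x) + Suc 0 = dsum_on V d u"
    unfolding dsum_on_def using assms fin by (simp add: sum.remove[of V "l u"] core_leaf_dist)
  ultimately show ?thesis using pos dsum_core[OF assms] by linarith
qed

lemma ecc_core:
  assumes "u \<in> H"
  shows "ecc_on V d u = Suc (ecc_on H d u)"
proof (rule ecc_eqI)
  fix x assume "x \<in> V"
  then show "d u x \<le> Suc (ecc_on H d u)"
    using core.ecc_ge[OF assms] core_leaf_dist assms partition by (auto intro: le_SucI)
next
  obtain y where "y \<in> H" "ecc_on H d u = d u y" using core.ecc_attained by blast
  then show "\<exists>x\<in>V. d u x = Suc (ecc_on H d u)"
    using core_leaf_dist assms by (intro bexI[of _ "l y"]) auto
qed

text \<open>For a single core vertex the eccentricity of its leaf is 1, hence the bound on the size of H.\<close>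

lemma ecc_leaf:
  assumes "u \<in> H" "card H \<ge> 2"
  shows "ecc_on V d (l u) = ecc_on H d u + 2"
proof (rule ecc_eqI)
  fix x assume "x \<in> V"
  then show "d (l u) x \<le> ecc_on H d u + 2"
    using leaf_dist[of u x] ecc_ge[of u x] ecc_core assms by (cases "x = l u") auto
next
  obtain y where y: "y \<in> H" "ecc_on H d u = d u y" using core.ecc_attained by blast
  \<comment> \<open>A second core vertex forces the farthest vertex \<open>y\<close> to differ from
    \<open>u\<close>, so \<open>leaves_dist\<close> applies to the two leaves.\<close>
  have "H \<noteq> {u}" using assms(2) by auto
  then obtain x where "x \<in> H" "x \<noteq> u" using assms(1) by blast
  then have "d u x \<noteq> 0" "d u x \<le> d u y"
    using zero_iff[of u x] core.ecc_ge[of u x] y assms(1) by auto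
  then have "y \<noteq> u" using assms(1) by auto
  then show "\<exists>x\<in>V. d (l u) x = ecc_on H d u + 2"
    using y leaves_dist assms by (intro bexI[of _ "l y"]) auto
qed

text \<open>With \<open>e\<close> and \<open>D\<close> the eccentricity and distance sum of
  \<open>u\<close> in \<open>H\<close> and \<open>m = card H\<close>, the vertex \<open>u\<close>
  contributes \<open>(e + 1) * (2 * D + m)\<close> and its leaf
  \<open>(e + 2) * (2 * D + 3 * m - 2)\<close>. The coefficients are nonnegative, so it suffices to
  bound the three totals over \<open>H\<close>.\<close>

theorem eds_corona:
  assumes m: "card H \<ge> 2"
  shows "eds_on V d = 4 * eds_on H d + (4 * card H - 2) * ecc_total H d + 6 * dsum_total H d
    + card H * (7 * card H - 4)"
proof -
  obtain k where k: "card H = k + 2" using m by (metis add.commute le_Suc_ex)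
  have "eds_on V d = (\<Sum>u\<in>H. Suc (ecc_on H d u) * (2 * dsum_on H d u + card H)
      + (ecc_on H d u + 2) * (2 * dsum_on H d u + (3 * card H - 2)))"
    unfolding eds_on_def sum_corona sum.distrib using m
    by (simp add: ecc_core ecc_leaf dsum_core dsum_leaf)
  also have "\<dots> = (\<Sum>u\<in>H. 4 * (ecc_on H d u * dsum_on H d u) + (4 * card H - 2) * ecc_on H d u
      + 6 * dsum_on H d u + (7 * card H - 4))"
    unfolding k by (rule sum.cong) (simp_all add: algebra_simps)
  also have "\<dots> = 4 * eds_on H d + (4 * card H - 2) * ecc_total H d + 6 * dsum_total H d
    + card H * (7 * card H - 4)"
    by (simp add: eds_on_def ecc_total_def dsum_total_def sum.distrib sum_distrib_left)
  finally show ?thesis .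
qed

end

text \<open>Serves the one-vertex core, which \<open>eds_corona\<close> excludes.\<close>

lemma (in graph_metric) eds_two_vertices:
  assumes "card V = 2"
  shows "eds_on V d = 2"
proof -
  obtain x y where V: "V = {x, y}" "x \<noteq> y" using assms by (metis card_2_iff)
  have "d x y = 1" using step[of x y] V zero_iff[of x y] by auto
  then have "d y x = 1" using sym V by auto
  then show ?thesis using V \<open>d x y = 1\<close> refl
    by (simp add: eds_on_def ecc_on_def dsum_on_def)
qed

lemma tree_metric_subset:
  assumes "tree_metric V d" "graph_metric H d" "H \<subseteq> V"
  shows "tree_metric H d"
proof -
  interpret tree_metric V d by fact
  interpret H: graph_metric H d by fact
  show ?thesis
  proof
    fix r v x y
    assume "r \<in> H" "v \<in> H" "x \<in> H" "y \<in> H" "d v x = 1" "d v y = 1" "d r x \<le> d r v" "d r y \<le> d r v"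
    then show "x = y" by (intro parent_unique[of r v x y] subsetD[OF assms(3)])
  qed
qed

theorem eds_corona_le:
  assumes T: "tree_metric V d" and C: "corona_metric V d H l" and m: "card H \<ge> 2"
  shows "eds_on V d \<le> 4 * eds_on {..<card H} path_dist + (4 * card H - 2) * ecc_total {..<card H} path_dist
    + 6 * dsum_total {..<card H} path_dist + card H * (7 * card H - 4)"
proof -
  interpret corona_metric V d H l by fact
  interpret H: tree_metric H d
    using tree_metric_subset[OF T core_graph_metric] partition by blast
  have "4 * eds_on H d + (4 * card H - 2) * ecc_total H d + 6 * dsum_total H d \<le>
      4 * eds_on {..<card H} path_dist + (4 * card H - 2) * ecc_total {..<card H} path_dist
      + 6 * dsum_total {..<card H} path_dist"
    using H.totals_le_path by (intro add_mono mult_left_mono) simp_all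
  then show ?thesis
    unfolding eds_corona[OF m] by simp
qed

section \<open>Trees whose domination number is half their order\<close>

text \<open>Relative to \<open>A\<close>, so that the two sides of a deleted edge can be dominated
  separately.\<close>

definition dominates :: "('a \<Rightarrow> 'a \<Rightarrow> nat) \<Rightarrow> 'a set \<Rightarrow> 'a set \<Rightarrow> bool" where
  "dominates d S A \<longleftrightarrow> S \<subseteq> A \<and> (\<forall>v\<in>A - S. \<exists>s\<in>S. d v s = 1)"

context graph_metric
begin

text \<open>Every vertex of \<open>A\<close> has a neighbour in \<open>A\<close> whose distance from
  \<open>c\<close> has the other parity, so both parity classes dominate \<open>A\<close>, and the
  smaller one has at most half its size.\<close>

lemma half_domination:
  assumes A: "A \<subseteq> V" "c \<in> A" "card A \<ge> 2"
    and par: "\<And>x. x \<in> A - {c} \<Longrightarrow> \<exists>y\<in>A. d x y = 1 \<and> d c x = Suc (d c y)"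
  shows "\<exists>S. dominates d S A \<and> 2 * card S \<le> card A"
proof -
  have finA: "finite A" using A fin finite_subset by blast
  have nb: "\<exists>y\<in>A. d x y = 1 \<and> even (d c y) \<noteq> even (d c x)" if x: "x \<in> A" for x
  proof (cases "x = c")
    case False
    then show ?thesis using par[of x] x by fastforce
  next
    case True
    \<comment> \<open>\<open>c\<close> has no parent. A vertex of \<open>A - {c}\<close> closest to
      \<open>c\<close> has \<open>c\<close> as its parent, and so is a neighbour of \<open>c\<close>
      on level 1.\<close>
    have "A \<noteq> {c}" using A(3) by auto
    then have "d c ` (A - {c}) \<noteq> {}" using A(2) by blast
    then have "Min (d c ` (A - {c})) \<in> d c ` (A - {c})" using finA by (intro Min_in) auto
    then obtain a where a: "a \<in> A - {c}" "d c a = Min (d c ` (A - {c}))" by (metis imageE)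
    then have min: "d c a \<le> d c b" if "b \<in> A - {c}" for b using that finA by auto
    obtain y where y: "y \<in> A" "d a y = 1" "d c a = Suc (d c y)" using par[OF a(1)] by blast
    then have "y = c" using min[of y] by auto
    then have "d c a = 1" "d x a = 1" using y(3) A True by auto
    then show ?thesis using a(1) A True by (intro bexI[of _ a]) auto
  qed
  define E where "E = {x\<in>A. even (d c x)}"
  define D where "D = {x\<in>A. odd (d c x)}"
  have "dominates d E A" "dominates d D A"
    unfolding dominates_def E_def D_def using nb by blast+
  moreover have "card E + card D = card A"
  proof -
    have "A = E \<union> D" "E \<inter> D = {}" by (auto simp: E_def D_def)
    then show ?thesis using card_Un_disjoint[of E D] finA by simp
  qed
  ultimately show ?thesis by (cases "card E \<le> card D") auto
qed

text \<open>\<open>A\<close> and \<open>B\<close> are the two sides of the edge from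
  \<open>v\<close> to \<open>c\<close>. A geodesic step towards the own end shortens that distance
  by one and the distance to the other end by at most one, so it stays on its side and
  \<open>half_domination\<close> applies to each. If both sides are odd, rounding down twice saves a
  vertex.\<close>

lemma split_domination:
  assumes v: "v \<in> V" and c: "c \<in> V" and vc: "d v c = 1"
  defines "A \<equiv> {x\<in>V. d c x < d v x}" and "B \<equiv> {x\<in>V. d v x \<le> d c x}"
  assumes cA: "card A \<ge> 2" and cB: "card B \<ge> 2"
  shows "\<exists>S. dominates d S V \<and> card S \<le> card A div 2 + card B div 2"
proof -
  have lip: "d v y \<le> Suc (d v x)" "d v x \<le> Suc (d v y)" "d c y \<le> Suc (d c x)" "d c x \<le> Suc (d c y)"
    if "x \<in> V" "y \<in> V" "d x y = 1" for x y
    using tri[of v x y] tri[of v y x] tri[of c x y] tri[of c y x] that v c sym[of x y] by auto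
  have cv: "d c v = 1" using sym v c vc by simp
  have "\<exists>S. dominates d S A \<and> 2 * card S \<le> card A"
  proof (rule half_domination[of A c])
    fix x assume x: "x \<in> A - {c}"
    then obtain y where y: "y \<in> V" "d x y = 1" "d x c = Suc (d y c)" using step c by (auto simp: A_def)
    then have "d c x = Suc (d c y)" using sym c x by (auto simp: A_def)
    then show "\<exists>y\<in>A. d x y = 1 \<and> d c x = Suc (d c y)"
      using y x lip[of x y] by (auto simp: A_def)
  qed (use cA c vc in \<open>auto simp: A_def\<close>)
  then obtain S where S: "dominates d S A" "card S \<le> card A div 2" by auto
  have "\<exists>S. dominates d S B \<and> 2 * card S \<le> card B"
  proof (rule half_domination[of B v])
    fix x assume x: "x \<in> B - {v}"
    then obtain y where y: "y \<in> V" "d x y = 1" "d x v = Suc (d y v)" using step v by (auto simp: B_def)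
    then have "d v x = Suc (d v y)" using sym v x by (auto simp: B_def)
    then show "\<exists>y\<in>B. d x y = 1 \<and> d v x = Suc (d v y)"
      using y x lip[of x y] by (auto simp: B_def)
  qed (use cB v in \<open>auto simp: B_def\<close>)
  then obtain S' where S': "dominates d S' B" "card S' \<le> card B div 2" by auto
  have "V = A \<union> B" by (auto simp: A_def B_def)
  then have "dominates d (S \<union> S') V" using S(1) S'(1) unfolding dominates_def by blast
  moreover have "card (S \<union> S') \<le> card A div 2 + card B div 2"
    using card_Un_le[of S S'] S(2) S'(2) by linarith
  ultimately show ?thesis by blast
qed

end

context tree_metric
begin

text \<open>The branches \<open>A c\<close> at \<open>v\<close> partition the
  \<open>2 * m - 1\<close> other vertices, so one of them is odd. If it had two or more vertices,
  both sides of the edge from \<open>v\<close> to \<open>c\<close> would be odd with at least two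
  vertices, and \<open>split_domination\<close> would give a dominating set of size below
  \<open>m\<close>. So this branch is \<open>{c}\<close>.\<close>

lemma has_leaf_neighbour:
  assumes m: "card V = 2 * m" and dom: "\<And>S. dominates d S V \<Longrightarrow> m \<le> card S"
    and v: "v \<in> V" and ab: "a \<in> V" "b \<in> V" "a \<noteq> b" "d v a = 1" "d v b = 1"
  shows "\<exists>c\<in>V. d v c = 1 \<and> (\<forall>x\<in>V. d c x = 1 \<longrightarrow> x = v)"
proof -
  define N where "N = {c\<in>V. d v c = 1}"
  define A where "A c = {x\<in>V. d c x < d v x}" for c
  have "\<not> (\<forall>c\<in>N. even (card (A c)))"
  proof
    assume even: "\<forall>c\<in>N. even (card (A c))"
    have U: "(\<Union>c\<in>N. A c) = V - {v}"
    proof (intro equalityI subsetI)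
      fix x assume "x \<in> V - {v}"
      then obtain z where "z \<in> V" "d v z = 1" "d v x = Suc (d z x)" using step[of v x] v by auto
      then show "x \<in> (\<Union>c\<in>N. A c)" using \<open>x \<in> V - {v}\<close> by (auto simp: N_def A_def intro!: exI[of _ z])
    qed (use v in \<open>auto simp: A_def\<close>)
    have "2 dvd card (\<Union> (A ` N))"
    proof (rule dvd_partition)
      show "\<forall>C\<in>A ` N. \<forall>C'\<in>A ` N. C \<noteq> C' \<longrightarrow> C \<inter> C' = {}"
      proof (intro ballI impI, rule ccontr)
        fix C C' assume "C \<in> A ` N" "C' \<in> A ` N" "C \<noteq> C'" "C \<inter> C' \<noteq> {}"
        then obtain c c' x where "c \<in> N" "c' \<in> N" "C = A c" "C' = A c'" "x \<in> A c" "x \<in> A c'" by blast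
        moreover from this have "c = c'"
          using parent_unique[of x v c c'] v sym[of x] by (auto simp: A_def N_def)
        ultimately show False using \<open>C \<noteq> C'\<close> by simp
      qed
    qed (use U fin even in auto)
    then have "even (2 * m - 1)" using U m v by simp
    moreover have "m > 0" using m v fin by (metis card_gt_0_iff empty_iff nat_0_less_mult_iff)
    ultimately show False by presburger
  qed
  then obtain c where c: "c \<in> V" "d v c = 1" and odd: "odd (card (A c))" by (auto simp: N_def)
  have finA: "finite (A c)" using fin by (simp add: A_def)
  have cA: "c \<in> A c" using c by (simp add: A_def)
  have "card (A c) < 2"
  proof (rule ccontr)
    assume A2: "\<not> card (A c) < 2"
    let ?B = "{x\<in>V. d v x \<le> d c x}"
    \<comment> \<open>A second neighbour of \<open>v\<close> ensures that the side of
      \<open>v\<close> has two vertices.\<close>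
    obtain c' where c': "c' \<in> V" "d v c' = 1" "c' \<noteq> c" using ab by metis
    then have "d c c' \<noteq> 0" using zero_iff c by auto
    then have "{v, c'} \<subseteq> ?B" using v c' by auto
    moreover have "card {v, c'} = 2" using adjacent_neq v c' by force
    ultimately have B2: "card ?B \<ge> 2" using card_mono[of ?B "{v, c'}"] fin by simp
    have "A c \<union> ?B = V" "A c \<inter> ?B = {}" by (auto simp: A_def)
    then have sum: "card (A c) + card ?B = 2 * m"
      using card_Un_disjoint[of "A c" ?B] finA fin m by simp
    obtain S where "dominates d S V" "card S \<le> card (A c) div 2 + card ?B div 2"
      using split_domination[OF v c] A2 B2 unfolding A_def by auto
    with dom have "m \<le> card (A c) div 2 + card ?B div 2" by fastforce
    with sum odd show False by presburger
  qed
  moreover have "card (A c) \<noteq> 0" using cA finA by auto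
  ultimately have "card (A c) = 1" by linarith
  then have Ac: "A c = {c}" using cA by (metis card_1_singletonE singletonD)
  \<comment> \<open>Another neighbour of \<open>c\<close> would lie one level further from
    \<open>v\<close>, inside the branch \<open>A c\<close>.\<close>
  have "x = v" if x: "x \<in> V" "d c x = 1" for x
  proof (rule ccontr)
    assume "x \<noteq> v"
    then have "d v x \<noteq> 0" using zero_iff v x by auto
    moreover have "d v x \<noteq> 1" using adjacent_levels_differ[of v c x] v c x by auto
    ultimately have "x \<in> A c" using x by (auto simp: A_def)
    then show False using Ac x c by auto
  qed
  then show ?thesis using c by blast
qed

theorem corona_of_domination:
  assumes m: "card V = 2 * m" "m \<ge> 2" and dom: "\<And>S. dominates d S V \<Longrightarrow> m \<le> card S"
  shows "\<exists>H l. corona_metric V d H l"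
proof -
  define L where "L = {x\<in>V. \<exists>y\<in>V. d x y = 1 \<and> (\<forall>z\<in>V. d x z = 1 \<longrightarrow> z = y)}"
  define H where "H = V - L"
  have big: "\<exists>z\<in>V. z \<notin> {x, y}" for x y
  proof (rule ccontr)
    assume "\<not> ?thesis"
    then have "card V \<le> card {x, y}" by (intro card_mono) auto
    also have "\<dots> \<le> 2" by (simp add: card_insert_if)
    finally show False using m by simp
  qed
  have nb: "\<exists>y\<in>V. d x y = 1" if "x \<in> V" for x
    using big[of x x] step[of x] that by auto
  have "\<exists>c\<in>V. d v c = 1 \<and> (\<forall>x\<in>V. d c x = 1 \<longrightarrow> x = v)" if "v \<in> H" for v
  proof -
    have v: "v \<in> V" "v \<notin> L" using that by (auto simp: H_def)
    obtain a where a: "a \<in> V" "d v a = 1" using nb v by blast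
    then obtain b where "b \<in> V" "d v b = 1" "b \<noteq> a" using v unfolding L_def by blast
    then show ?thesis using has_leaf_neighbour[OF m(1) dom v(1), of a b] a by blast
  qed
  then obtain l where l: "\<And>v. v \<in> H \<Longrightarrow> l v \<in> V \<and> d v (l v) = 1 \<and> (\<forall>x\<in>V. d (l v) x = 1 \<longrightarrow> x = v)"
    by metis
  have HV: "H \<subseteq> V" by (auto simp: H_def)
  have lsym: "d (l v) v = 1" if "v \<in> H" for v using l[OF that] sym HV that by auto
  have lL: "l ` H \<subseteq> L" using l lsym HV unfolding L_def by blast
  have inj: "inj_on l H" by (rule inj_onI) (metis HV l lsym subsetD)
  have "dominates d H V"
    unfolding dominates_def
  proof (intro conjI ballI HV)
    fix x assume "x \<in> V - H"
    then obtain y where x: "x \<in> V" and y: "y \<in> V" "d x y = 1" "\<And>z. z \<in> V \<Longrightarrow> d x z = 1 \<Longrightarrow> z = y"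
      unfolding H_def L_def by blast
    \<comment> \<open>If \<open>x\<close> and \<open>y\<close> were adjacent leaves, a geodesic from
      either one to a third vertex would start with the other, which is absurd.\<close>
    have "y \<notin> L"
    proof
      assume "y \<in> L"
      then obtain u where u: "\<And>z. z \<in> V \<Longrightarrow> d y z = 1 \<Longrightarrow> z = u"
        unfolding L_def by blast
      have "d y x = 1" using y(2) sym[OF x y(1)] by simp
      then have yx: "z = x" if "z \<in> V" "d y z = 1" for z using u x that by metis
      obtain z where z: "z \<in> V" "z \<noteq> x" "z \<noteq> y" using big[of x y] by blast
      have "d x z = Suc (d y z)" using step[of x z] x z y(3) by blast
      moreover have "d y z = Suc (d x z)" using step[of y z] y(1) z yx by blast
      ultimately show False by simp
    qed
    then show "\<exists>s\<in>H. d x s = 1" using y unfolding H_def by blast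
  qed
  \<comment> \<open>Now \<open>L\<close> has at most \<open>m\<close> elements, while
    \<open>l\<close> embeds \<open>H\<close> with at least \<open>m\<close> elements into it; so
    \<open>l\<close> maps onto \<open>L\<close>.\<close>
  then have "m \<le> card H" by (rule dom)
  moreover have "card H + card L = 2 * m"
  proof -
    have "V = H \<union> L" "H \<inter> L = {}" by (auto simp: H_def L_def)
    then show ?thesis using card_Un_disjoint[of H L] fin m(1) by simp
  qed
  moreover have "card (l ` H) = card H" using inj by (rule card_image)
  moreover have finL: "finite L" using fin by (simp add: L_def)
  ultimately have lHL: "l ` H = L" using lL card_mono[OF finL lL] by (intro card_subset_eq) linarith+
  have "corona_metric V d H l"
  proof
    show "V = H \<union> l ` H" "H \<inter> l ` H = {}" unfolding lHL by (auto simp: H_def L_def)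
    show "inj_on l H" by (rule inj)
    fix u x assume "u \<in> H" "x \<in> V"
    then show "d (l u) x = 1 \<longleftrightarrow> x = u" using l[of u] lsym[of u] by blast
  qed
  then show ?thesis by blast
qed

end

section \<open>Graph distance\<close>

lemma (in pair_graph) gdist_le: "awalk u p v \<Longrightarrow> gdist G u v \<le> length p"
  unfolding gdist_def by (rule Least_le) blast

locale connected_pair_graph = pair_graph +
  assumes conn: "Digraph_Component.connected (with_proj G)"
begin

lemma nonempty: "pverts G \<noteq> {}"
  using conn by (auto simp: connected_conv)

text \<open>Connectedness ignores the direction of arcs; symmetry makes it strong, so the set under
  \<open>LEAST\<close> is nonempty and the minimum is attained.\<close>

lemma gdist_walk:
  assumes "u \<in> pverts G" "v \<in> pverts G"
  obtains p where "awalk u p v" "length p = gdist G u v"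
proof -
  have "strongly_connected (with_proj G)"
    using symmetric_connected_imp_strongly_connected[OF pair_sym_arcs conn] .
  then have "u \<rightarrow>\<^sup>*\<^bsub>with_proj G\<^esub> v" using assms by (auto elim: strongly_connectedE)
  then obtain q where "awalk u q v" using reachable_awalk by blast
  then have "\<exists>k p. awalk u p v \<and> length p = k" by blast
  then have "\<exists>p. awalk u p v \<and> length p = gdist G u v"
    unfolding gdist_def by (rule LeastI_ex)
  then show thesis using that by blast
qed

lemma gdist_eq_0: "\<lbrakk>u \<in> pverts G; v \<in> pverts G\<rbrakk> \<Longrightarrow> gdist G u v = 0 \<longleftrightarrow> u = v"
  using gdist_le[of u "[]" v] by (metis awalk_Nil_iff gdist_walk le_zero_eq length_0_conv)

lemma gdist_commute:
  assumes "u \<in> pverts G" "v \<in> pverts G"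
  shows "gdist G u v = gdist G v u"
proof -
  have len: "length (rev_path p) = length p" for p :: "('a \<times> 'a) list" by (induction p) auto
  have "gdist G x y \<le> gdist G y x" if "x \<in> pverts G" "y \<in> pverts G" for x y
    using gdist_walk[OF that(2,1)] gdist_le[of x _ y] awalk_rev_path len by metis
  then show ?thesis using assms by (simp add: le_antisym)
qed

lemma gdist_triangle:
  assumes "x \<in> pverts G" "y \<in> pverts G" "z \<in> pverts G"
  shows "gdist G x z \<le> gdist G x y + gdist G y z"
proof -
  obtain p where "awalk x p y" "length p = gdist G x y" using gdist_walk assms by blast
  moreover obtain q where "awalk y q z" "length q = gdist G y z" using gdist_walk assms by blast
  ultimately show ?thesis using gdist_le[OF awalk_appendI, of x p y q z] by simp
qed

lemma gdist_eq_1: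
  assumes "u \<in> pverts G" "v \<in> pverts G"
  shows "gdist G u v = 1 \<longleftrightarrow> (u, v) \<in> parcs G"
proof
  assume "gdist G u v = 1"
  then obtain p where p: "awalk u p v" "length p = 1" using gdist_walk assms by metis
  then obtain e where "p = [e]" by (metis One_nat_def length_0_conv length_Suc_conv)
  then have "e \<in> parcs G \<and> fst e = u \<and> snd e = v" using p by (auto simp: awalk_simps)
  then show "(u, v) \<in> parcs G" by force
next
  assume uv: "(u, v) \<in> parcs G"
  then have "awalk u [(u, v)] v" using assms by (auto simp: awalk_simps)
  from gdist_le[OF this] have "gdist G u v \<le> 1" by simp
  moreover have "gdist G u v \<noteq> 0" using uv no_loops' gdist_eq_0 assms by blast
  ultimately show "gdist G u v = 1" by simp
qed

lemma gdist_step: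
  assumes "x \<in> pverts G" "y \<in> pverts G" "x \<noteq> y"
  shows "\<exists>z\<in>pverts G. gdist G x z = 1 \<and> gdist G x y = Suc (gdist G z y)"
proof -
  obtain p where p: "awalk x p y" "length p = gdist G x y" using gdist_walk assms by blast
  have "p \<noteq> []" using p assms by (auto simp: awalk_simps)
  then obtain z es where "p = (x, z) # es" using p by (cases p) (auto simp: awalk_simps)
  with p have z: "(x, z) \<in> parcs G" "awalk z es y" "gdist G x y = Suc (length es)"
    by (auto simp: awalk_simps)
  have zV: "z \<in> pverts G" using in_arcsD2 z(1) .
  then have xz: "gdist G x z = 1" using gdist_eq_1[of x z] z(1) assms by simp
  have "gdist G z y \<le> length es" using z(2) by (rule gdist_le)
  moreover have "gdist G x y \<le> gdist G x z + gdist G z y" using gdist_triangle assms zV by simp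
  ultimately show ?thesis using z(3) xz zV by (intro bexI[of _ z]) auto
qed

sublocale gm: graph_metric "pverts G" "gdist G"
  using pair_finite_verts nonempty gdist_eq_0 gdist_commute gdist_triangle gdist_step
  by unfold_locales

lemma ecc_dist_sum_eq: "ecc_dist_sum G = eds_on (pverts G) (gdist G)"
  unfolding ecc_dist_sum_def eds_on_def dist_sum_def dsum_on_def eccentricity_def ecc_on_def
  by (intro sum.cong arg_cong2[where f = "(*)"]) (auto intro: gdist_commute)

lemma dominating_set_iff: "dominating_set G S \<longleftrightarrow> dominates (gdist G) S (pverts G)"
  unfolding dominating_set_def dominates_def using gdist_eq_1 by blast

text \<open>A geodesic to \<open>r\<close> avoids \<open>v\<close>: its first vertex differs from
  \<open>v\<close>, and all later ones are strictly closer to \<open>r\<close> than \<open>v\<close>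
  is.\<close>

lemma descending_walk_avoiding:
  assumes "v \<in> pverts G" "r \<in> pverts G" "x \<in> pverts G" "x \<noteq> v" "gdist G x r \<le> gdist G v r"
  shows "\<exists>p. awalk x p r \<and> v \<notin> set (awalk_verts x p)"
  using assms(3-)
proof (induction "gdist G x r" arbitrary: x)
  case 0
  then have "x = r" using gdist_eq_0 assms by metis
  then show ?case using 0 by (intro exI[of _ "[]"]) (auto simp: awalk_simps)
next
  case (Suc k)
  then have "x \<noteq> r" using gdist_eq_0 assms by fastforce
  then obtain z where z: "z \<in> pverts G" "gdist G x z = 1" "gdist G x r = Suc (gdist G z r)"
    using gdist_step assms Suc.prems by blast
  then obtain p where "awalk z p r" "v \<notin> set (awalk_verts z p)"
    using Suc.hyps(1)[of z] Suc.hyps(2) Suc.prems by fastforce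
  then show ?case using z Suc.prems gdist_eq_1[of x z]
    by (intro exI[of _ "(x, z) # p"]) (auto simp: awalk_simps)
qed

text \<open>Shortening a walk to a path uses only its own arcs, so no vertex is added.\<close>

lemma apath_avoiding:
  assumes "awalk x p y" "v \<notin> set (awalk_verts x p)"
  obtains q where "apath x q y" "v \<notin> set (awalk_verts x q)"
proof (rule that)
  let ?q = "awalk_to_apath p"
  show q: "apath x ?q y" using apath_awalk_to_apath assms by blast
  have "set (awalk_verts x ?q) \<subseteq> set (awalk_verts x p)"
    using set_awalk_verts[OF assms(1)] set_awalk_verts[OF awalkI_apath[OF q]]
      awalk_to_apath_subset[OF assms(1)] by auto
  then show "v \<notin> set (awalk_verts x ?q)" using assms by blast
qed

text \<open>For \<open>x \<noteq> y\<close>, descending walks from both to \<open>r\<close> join to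
  a walk from \<open>x\<close> to \<open>y\<close> that avoids \<open>v\<close>. Shortened to a
  path, which is nonempty, and closed through \<open>v\<close>, it is a cycle with at least 3
  arcs.\<close>

lemma parent_unique_if_acyclic:
  assumes acyclic: "\<not> (\<exists>p. cycle p \<and> 3 \<le> length p)"
    and V: "r \<in> pverts G" "v \<in> pverts G" "x \<in> pverts G" "y \<in> pverts G"
    and "gdist G v x = 1" "gdist G v y = 1" "gdist G r x \<le> gdist G r v" "gdist G r y \<le> gdist G r v"
  shows "x = y"
proof (rule ccontr)
  assume "x \<noteq> y"
  have le: "gdist G x r \<le> gdist G v r" "gdist G y r \<le> gdist G v r"
    using assms gdist_commute by metis+
  have arcs: "(v, x) \<in> parcs G" "(v, y) \<in> parcs G" using assms gdist_eq_1 by blast+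
  have "x \<noteq> v" "y \<noteq> v" using arcs no_loops' by blast+
  then obtain p where p: "awalk x p r" "v \<notin> set (awalk_verts x p)"
    using descending_walk_avoiding V le by blast
  obtain p' where p': "awalk y p' r" "v \<notin> set (awalk_verts y p')"
    using descending_walk_avoiding V le \<open>y \<noteq> v\<close> by blast
  have rp: "awalk r (rev_path p') y" using p' by simp
  have "set (awalk_verts r (rev_path p')) = set (awalk_verts y p')"
    using awalk_verts_rev_path[OF p'(1)] by simp
  then have "v \<notin> set (awalk_verts x (p @ rev_path p'))"
    using set_awalk_verts_append[OF p(1) rp] p(2) p'(2) by simp
  then obtain q where q: "apath x q y" "v \<notin> set (awalk_verts x q)"
    using apath_avoiding awalk_appendI[OF p(1) rp] by blast
  have qw: "awalk x q y" using q(1) by (rule awalkI_apath)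
  have yv: "awalk y [(y, v)] v" using arcs arcs_symmetric V by (auto simp: awalk_simps)
  have "q \<noteq> []" using qw \<open>x \<noteq> y\<close> by (auto simp: awalk_simps)
  have "awalk v ((v, x) # (q @ [(y, v)])) v"
    using awalk_appendI[OF qw yv] arcs by (auto simp: awalk_simps)
  moreover have "awalk_verts x (q @ [(y, v)]) = awalk_verts x q @ [v]"
    using awalk_verts_append[OF awalk_appendI[OF qw yv]] qw by simp
  then have "distinct (tl (awalk_verts v ((v, x) # (q @ [(y, v)]))))"
    using q by (simp add: apath_def)
  ultimately have "cycle ((v, x) # (q @ [(y, v)]))" unfolding cycle_def by blast
  moreover have "3 \<le> length ((v, x) # (q @ [(y, v)]))" using \<open>q \<noteq> []\<close> by (cases q) auto
  ultimately show False using acyclic by blast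
qed

end

lemma undirected_tree_metric:
  assumes "undirected_tree G"
  shows "connected_pair_graph G" "tree_metric (pverts G) (gdist G)"
proof -
  show G: "connected_pair_graph G"
    using assms unfolding undirected_tree_def connected_pair_graph_def connected_pair_graph_axioms_def by blast
  interpret connected_pair_graph G by fact
  have "\<not> (\<exists>p. cycle p \<and> 3 \<le> length p)" using assms unfolding undirected_tree_def by blast
  from parent_unique_if_acyclic[OF this]
  show "tree_metric (pverts G) (gdist G)" by unfold_locales
qed

lemma domination_number_le:
  assumes "pair_graph G" "dominating_set G S"
  shows "domination_number G \<le> card S"
proof -
  interpret pair_graph G by fact
  have "{S. dominating_set G S} \<subseteq> Pow (pverts G)" by (auto simp: dominating_set_def)
  then have "finite {S. dominating_set G S}" using pair_finite_verts finite_subset by blast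
  then show ?thesis unfolding domination_number_def using assms(2) by simp
qed

section \<open>The corona of a path\<close>

text \<open>Following \<open>step\<close> lowers \<delta> by one at a time down to 0. The walk
  obtained also proves the corona of the path connected.\<close>

lemma (in pair_graph) awalk_of_distance_function:
  fixes \<delta> :: "'a \<Rightarrow> 'a \<Rightarrow> nat"
  assumes zero: "\<And>x y. \<lbrakk>x \<in> pverts G; y \<in> pverts G\<rbrakk> \<Longrightarrow> \<delta> x y = 0 \<longleftrightarrow> x = y"
    and step: "\<And>x z. \<lbrakk>x \<in> pverts G; z \<in> pverts G; x \<noteq> z\<rbrakk> \<Longrightarrow> \<exists>y. (x, y) \<in> parcs G \<and> \<delta> x z = Suc (\<delta> y z)"
    and x: "x \<in> pverts G" and z: "z \<in> pverts G"
  shows "\<exists>p. awalk x p z \<and> length p = \<delta> x z"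
  using x
proof (induction "\<delta> x z" arbitrary: x)
  case 0
  then show ?case using zero[OF 0(2) z] z by (intro exI[of _ "[]"]) (auto simp: awalk_simps)
next
  case (Suc k)
  then have "x \<noteq> z" using zero[OF Suc.prems z] by auto
  then obtain y where y: "(x, y) \<in> parcs G" "\<delta> x z = Suc (\<delta> y z)" using step Suc.prems z by blast
  then obtain p where "awalk y p z" "length p = \<delta> y z"
    using Suc.hyps(1)[of y] Suc.hyps(2) in_arcsD2 by auto
  then show ?case using y by (intro exI[of _ "(x, y) # p"]) (auto simp: awalk_simps)
qed

text \<open>Certifies an explicit formula for the distance: \<open>step\<close> yields a walk of
  length \<open>\<delta> x z\<close>, and \<open>lipschitz\<close> rules out a shorter one.\<close>

lemma (in pair_graph) gdist_eqI:
  fixes \<delta> :: "'a \<Rightarrow> 'a \<Rightarrow> nat"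
  assumes zero: "\<And>x y. \<lbrakk>x \<in> pverts G; y \<in> pverts G\<rbrakk> \<Longrightarrow> \<delta> x y = 0 \<longleftrightarrow> x = y"
    and step: "\<And>x z. \<lbrakk>x \<in> pverts G; z \<in> pverts G; x \<noteq> z\<rbrakk> \<Longrightarrow> \<exists>y. (x, y) \<in> parcs G \<and> \<delta> x z = Suc (\<delta> y z)"
    and lipschitz: "\<And>x y z. \<lbrakk>(x, y) \<in> parcs G; z \<in> pverts G\<rbrakk> \<Longrightarrow> \<delta> x z \<le> Suc (\<delta> y z)"
    and x: "x \<in> pverts G" and z: "z \<in> pverts G"
  shows "gdist G x z = \<delta> x z"
  unfolding gdist_def
proof (rule Least_equality)
  show "\<exists>p. awalk x p z \<and> length p = \<delta> x z"
    using awalk_of_distance_function[of \<delta>] zero step x z by blast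
next
  have "\<delta> x z \<le> length p" if "awalk x p z" for x p
    using that
  proof (induction p arbitrary: x)
    case Nil
    then show ?case using zero z by (auto simp: awalk_simps)
  next
    case (Cons e p)
    then have "(x, snd e) \<in> parcs G" "awalk (snd e) p z" by (auto simp: awalk_simps)
    then show ?case using Cons.IH[of "snd e"] lipschitz[of x "snd e" z] z by simp
  qed
  then show "\<And>k. \<exists>p. awalk x p z \<and> length p = k \<Longrightarrow> \<delta> x z \<le> k" by blast
qed

text \<open>On a cycle of length at least 3, a vertex with maximal \<open>h\<close> would have two
  distinct neighbours that are not higher.\<close>

lemma (in pair_graph) acyclicI:
  fixes h :: "'a \<Rightarrow> nat"
  assumes unique: "\<And>v x y. \<lbrakk>(v, x) \<in> parcs G; (v, y) \<in> parcs G; h x \<le> h v; h y \<le> h v\<rbrakk> \<Longrightarrow> x = y"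
  shows "\<not> (\<exists>p. cycle p \<and> 3 \<le> length p)"
proof
  assume "\<exists>p. cycle p \<and> 3 \<le> length p"
  then obtain u p where p: "awalk u p u" "distinct (tl (awalk_verts u p))" and k3: "3 \<le> length p"
    unfolding cycle_def by blast
  define vs where "vs = awalk_verts u p"
  define k where "k = length p"
  have len: "length vs = Suc k" unfolding vs_def k_def by (rule length_awalk_verts)
  have ends: "vs ! 0 = u" "vs ! k = u"
  proof -
    have "hd vs = u" "last vs = u" using p(1) unfolding vs_def by auto
    moreover have "vs \<noteq> []" using len by auto
    ultimately show "vs ! 0 = u" "vs ! k = u" using len by (simp_all add: hd_conv_nth last_conv_nth)
  qed
  have adj: "(vs ! i, vs ! Suc i) \<in> parcs G" if "i < k" for i
  proof -
    have "(awalk_verts a q ! i, awalk_verts a q ! Suc i) \<in> parcs G"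
      if "awalk a q b" "i < length q" for a q b i
      using that
    proof (induction q arbitrary: a i)
      case (Cons e q)
      then show ?case by (cases i; cases q) (auto simp: awalk_simps)
    qed simp
    then show ?thesis using p(1) that unfolding vs_def k_def by blast
  qed
  have inj: "i = j" if "vs ! i = vs ! j" "i \<in> {1..k}" "j \<in> {1..k}" for i j
  proof -
    have "tl vs ! (a - 1) = vs ! a" if "a \<in> {1..k}" for a
      using nth_tl[of "a - 1" vs] that len by auto
    then have "tl vs ! (i - 1) = tl vs ! (j - 1)" using that by simp
    then have "i - 1 = j - 1"
      using p(2) that len unfolding vs_def[symmetric] by (subst (asm) nth_eq_iff_index_eq) auto
    then show ?thesis using that by auto
  qed
  have k: "3 \<le> k" using k3 unfolding k_def .
  let ?M = "(\<lambda>i. h (vs ! i)) ` {1..k}"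
  have "Max ?M \<in> ?M" using k by (intro Max_in) auto
  then obtain i where i: "i \<in> {1..k}" "h (vs ! i) = Max ?M" by (metis imageE)
  have "h (vs ! j) \<le> h (vs ! i)" if "j \<in> {1..k}" for j
    unfolding i(2) using that by (intro Max_ge) auto
  from this this[of k] have max: "h (vs ! j) \<le> h (vs ! i)" if "j \<le> k" for j
    using that ends k by (cases "j = 0") auto
  \<comment> \<open>The cyclic predecessor and successor of \<open>i\<close> among the positions
    \<open>1..k\<close>, position 0 being the same vertex as position \<open>k\<close>. They differ
    because \<open>k\<close> is at least 3.\<close>
  define a where "a = (if i = 1 then k else i - 1)"
  define b where "b = (if i = k then 1 else Suc i)"
  have "(vs ! i, vs ! a) \<in> parcs G"
  proof (cases "i = 1")
    case True
    then show ?thesis using adj[of 0] ends k arcs_symmetric by (simp add: a_def)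
  next
    case False
    then show ?thesis using adj[of "i - 1"] i k arcs_symmetric by (auto simp: a_def)
  qed
  moreover have "(vs ! i, vs ! b) \<in> parcs G"
    using adj[of i] adj[of 0] ends i k by (auto simp: b_def)
  moreover have "h (vs ! a) \<le> h (vs ! i)" "h (vs ! b) \<le> h (vs ! i)"
    using max i k by (auto simp: a_def b_def)
  ultimately have "vs ! a = vs ! b" by (rule unique)
  then have "a = b" by (rule inj) (use i k in \<open>auto simp: a_def b_def\<close>)
  then show False using i k by (auto simp: a_def b_def split: if_splits)
qed

text \<open>Each end that is a leaf costs one extra edge. Equal first components are a separate case
  because a leaf would otherwise be at distance 2 from itself.\<close>

definition corona_path_dist :: "nat \<times> bool \<Rightarrow> nat \<times> bool \<Rightarrow> nat" where
  "corona_path_dist x y = (if fst x = fst y then of_bool (snd x \<noteq> snd y)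
    else path_dist (fst x) (fst y) + of_bool (snd x) + of_bool (snd y))"

lemma pverts_corona_path: "pverts (corona_K1 (path_graph m)) = {..<m} \<times> UNIV"
  by (simp add: corona_K1_def path_graph_def)

lemma parcs_corona_path:
  "((i, a), (j, b)) \<in> parcs (corona_K1 (path_graph m)) \<longleftrightarrow>
    i < m \<and> j < m \<and> (if i = j then a \<noteq> b else \<not> a \<and> \<not> b \<and> (j = Suc i \<or> i = Suc j))"
  by (auto simp: corona_K1_def path_graph_def)

lemma pair_graph_corona_path: "pair_graph (corona_K1 (path_graph m))"
proof
  let ?G = "corona_K1 (path_graph m)"
  show fin: "finite (pverts ?G)" by (simp add: pverts_corona_path)
  show V: "fst e \<in> pverts ?G" "snd e \<in> pverts ?G" if "e \<in> parcs ?G" for e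
    using that parcs_corona_path by (cases e; auto simp: pverts_corona_path)+
  then have "parcs ?G \<subseteq> pverts ?G \<times> pverts ?G" by (auto simp: mem_Times_iff)
  then show "finite (parcs ?G)" using fin finite_subset by blast
  show "fst e \<noteq> snd e" if "e \<in> parcs ?G" for e
    using that parcs_corona_path by (cases e) (auto split: if_splits)
  show "symmetric ?G"
    unfolding symmetric_def with_proj_simps by (rule symI) (auto simp: parcs_corona_path split: if_splits)
qed

lemma corona_path_dist_zero: "corona_path_dist x y = 0 \<longleftrightarrow> x = y"
  by (cases x; cases y) (auto simp: corona_path_dist_def path_dist_def)

lemma corona_path_dist_lipschitz:
  "(x, y) \<in> parcs (corona_K1 (path_graph m)) \<Longrightarrow> corona_path_dist x z \<le> Suc (corona_path_dist y z)"
  by (cases x; cases y; cases z)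
    (auto simp: parcs_corona_path corona_path_dist_def path_dist_def split: if_splits)

lemma corona_path_dist_step:
  assumes "x \<in> pverts (corona_K1 (path_graph m))" "z \<in> pverts (corona_K1 (path_graph m))" "x \<noteq> z"
  shows "\<exists>y. (x, y) \<in> parcs (corona_K1 (path_graph m)) \<and> corona_path_dist x z = Suc (corona_path_dist y z)"
proof -
  obtain i a j b where xz: "x = (i, a)" "z = (j, b)" by (cases x; cases z)
  with assms have ij: "i < m" "j < m" "(i, a) \<noteq> (j, b)" by (auto simp: pverts_corona_path)
  \<comment> \<open>The first step of a geodesic: leave a leaf for its core vertex, enter the leaf
    once above the target, or else move along the path towards \<open>j\<close>.\<close>
  define y where "y = (if a then (i, False) else if i = j then (i, True)
    else if i < j then (Suc i, False) else (i - 1, False))"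
  show ?thesis
    using ij unfolding xz
    by (intro exI[of _ y]) (auto simp: y_def parcs_corona_path corona_path_dist_def path_dist_def)
qed

lemma gdist_corona_path:
  "\<lbrakk>x \<in> {..<m} \<times> UNIV; y \<in> {..<m} \<times> UNIV\<rbrakk> \<Longrightarrow>
    gdist (corona_K1 (path_graph m)) x y = corona_path_dist x y"
  unfolding pverts_corona_path[symmetric]
  by (rule pair_graph.gdist_eqI[OF pair_graph_corona_path corona_path_dist_zero
        corona_path_dist_step corona_path_dist_lipschitz])

lemma undirected_tree_corona_path:
  assumes "m > 0"
  shows "undirected_tree (corona_K1 (path_graph m))"
proof -
  let ?G = "corona_K1 (path_graph m)"
  interpret pair_graph ?G by (rule pair_graph_corona_path)
  have "Digraph_Component.connected (with_proj ?G)"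
  proof (rule connectedI)
    show "pverts ?G \<noteq> {}" using assms by (auto simp: pverts_corona_path)
    fix u v assume uv: "u \<in> pverts ?G" "v \<in> pverts ?G"
    have "\<exists>p. awalk u p v \<and> length p = corona_path_dist u v"
      by (rule awalk_of_distance_function[OF corona_path_dist_zero corona_path_dist_step uv])
    then have "u \<rightarrow>\<^sup>*\<^bsub>with_proj ?G\<^esub> v" using reachable_awalk by blast
    then show "u \<rightarrow>\<^sup>*\<^bsub>with_proj (mk_symmetric ?G)\<^esub> v"
      using reachable_mk_symmetric_eq[OF pair_sym_arcs] by simp
  qed
  moreover have "\<not> (\<exists>p. cycle p \<and> 3 \<le> length p)"
  \<comment> \<open>This height puts each leaf between its core vertex and the next core vertex; so
    only the preceding core vertex, or for a leaf its own core vertex, is a neighbour that is not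
    higher.\<close>
  proof (rule acyclicI[of "\<lambda>x. 2 * fst x + of_bool (snd x)"])
    fix v x y
    assume "(v, x) \<in> parcs ?G" "(v, y) \<in> parcs ?G"
      "2 * fst x + of_bool (snd x) \<le> 2 * fst v + of_bool (snd v)"
      "2 * fst y + of_bool (snd y) \<le> 2 * fst v + of_bool (snd v)"
    then show "x = y"
      by (cases v; cases x; cases y) (auto simp: parcs_corona_path split: if_splits)
  qed
  ultimately show ?thesis
    using pair_graph_corona_path unfolding undirected_tree_def by blast
qed

text \<open>The core dominates. Conversely, each leaf and its only neighbour share their first
  component, so \<open>fst\<close> maps a dominating set onto \<open>{..<m}\<close>.\<close>

lemma domination_number_corona_path: "domination_number (corona_K1 (path_graph m)) = m"
  unfolding domination_number_def
proof (rule Min_eqI)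
  let ?G = "corona_K1 (path_graph m)"
  have "{S. dominating_set ?G S} \<subseteq> Pow ({..<m} \<times> UNIV)"
    by (auto simp: dominating_set_def pverts_corona_path)
  then show "finite (card ` {S. dominating_set ?G S})"
    by (intro finite_imageI) (rule finite_subset, auto)
  have "dominating_set ?G ({..<m} \<times> {False})"
    unfolding dominating_set_def pverts_corona_path
  proof (intro conjI ballI)
    fix v :: "nat \<times> bool" assume "v \<in> {..<m} \<times> UNIV - {..<m} \<times> {False}"
    then show "\<exists>s\<in>{..<m} \<times> {False}. (v, s) \<in> parcs ?G"
      by (intro bexI[of _ "(fst v, False)"]; cases v) (auto simp: parcs_corona_path)
  qed auto
  then show "m \<in> card ` {S. dominating_set ?G S}"
    by (intro image_eqI[of _ _ "{..<m} \<times> {False}"]) (auto simp: card_cartesian_product)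
  fix k assume "k \<in> card ` {S. dominating_set ?G S}"
  then obtain S where S: "k = card S" "dominating_set ?G S" by auto
  then have SV: "S \<subseteq> {..<m} \<times> UNIV" by (simp add: dominating_set_def pverts_corona_path)
  then have "finite S" using finite_subset by fastforce
  have "{..<m} \<subseteq> fst ` S"
  proof
    fix i assume i: "i \<in> {..<m}"
    show "i \<in> fst ` S"
    proof (cases "(i, True) \<in> S")
      case False
      then obtain s where "s \<in> S" "((i, True), s) \<in> parcs ?G"
        using S(2) i unfolding dominating_set_def pverts_corona_path by blast
      then show ?thesis by (cases s) (force simp: parcs_corona_path split: if_splits)
    qed force
  qed
  then have "card {..<m} \<le> card (fst ` S)" using \<open>finite S\<close> by (intro card_mono) auto
  also have "\<dots> \<le> card S" using \<open>finite S\<close> by (rule card_image_le)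
  finally show "m \<le> k" using S by simp
qed

lemma corona_path_mem_trees:
  "m > 0 \<Longrightarrow> corona_K1 (path_graph m) \<in> trees_with_domination (2 * m) m"
  unfolding trees_with_domination_def
  by (simp add: undirected_tree_corona_path domination_number_corona_path pverts_corona_path
      card_cartesian_product mult.commute)

lemma corona_metric_corona_path:
  assumes "m > 0"
  shows "corona_metric (pverts (corona_K1 (path_graph m))) (gdist (corona_K1 (path_graph m)))
    ({..<m} \<times> {False}) (\<lambda>x. (fst x, True))"
proof -
  interpret connected_pair_graph "corona_K1 (path_graph m)"
    by (rule undirected_tree_metric(1)[OF undirected_tree_corona_path[OF assms]])
  show ?thesis
  proof
    show "pverts (corona_K1 (path_graph m)) = {..<m} \<times> {False} \<union> (\<lambda>x. (fst x, True)) ` ({..<m} \<times> {False})"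
      by (auto simp: pverts_corona_path image_iff)
    show "inj_on (\<lambda>x. (fst x, True)) ({..<m} \<times> {False})" by (rule inj_onI) auto
    fix u x assume "u \<in> {..<m} \<times> {False}" "x \<in> pverts (corona_K1 (path_graph m))"
    then show "gdist (corona_K1 (path_graph m)) (fst u, True) x = 1 \<longleftrightarrow> x = u"
      by (subst gdist_corona_path) (auto simp: pverts_corona_path corona_path_dist_def path_dist_def)
  qed auto
qed

text \<open>The corona of the path attains the bound of \<open>eds_corona_le\<close>, since
  \<open>fst\<close> maps its core isometrically onto the path.\<close>

lemma eds_corona_path:
  assumes m: "m \<ge> 2"
  shows "ecc_dist_sum (corona_K1 (path_graph m)) =
    4 * eds_on {..<m} path_dist + (4 * m - 2) * ecc_total {..<m} path_dist
    + 6 * dsum_total {..<m} path_dist + m * (7 * m - 4)"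
proof -
  let ?G = "corona_K1 (path_graph m)"
  have m0: "m > 0" using m by simp
  interpret connected_pair_graph ?G
    by (rule undirected_tree_metric(1)[OF undirected_tree_corona_path[OF m0]])
  interpret corona_metric "pverts ?G" "gdist ?G" "{..<m} \<times> {False}" "\<lambda>x. (fst x, True)"
    by (rule corona_metric_corona_path[OF m0])
  have card: "card ({..<m} \<times> {False}) = m" by (simp add: card_cartesian_product)
  have bij: "bij_betw fst ({..<m} \<times> {False}) {..<m}"
    by (auto simp: bij_betw_def inj_on_def image_iff)
  have iso: "path_dist (fst x) (fst y) = gdist ?G x y"
    if "x \<in> {..<m} \<times> {False}" "y \<in> {..<m} \<times> {False}" for x y
    using that by (subst gdist_corona_path) (auto simp: corona_path_dist_def path_dist_def)
  show ?thesis
    using eds_corona core.totals_isometric[OF bij iso] m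
    unfolding ecc_dist_sum_eq card by simp
qed

theorem ecc_dist_sum_le_corona_path:
  assumes m: "m > 0" and T: "T \<in> trees_with_domination (2 * m) m"
  shows "ecc_dist_sum T \<le> ecc_dist_sum (corona_K1 (path_graph m))"
proof -
  have tree: "undirected_tree T" and card: "card (pverts T) = 2 * m" and dom: "domination_number T = m"
    using T by (auto simp: trees_with_domination_def)
  interpret connected_pair_graph T by (rule undirected_tree_metric(1)[OF tree])
  interpret tree_metric "pverts T" "gdist T" by (rule undirected_tree_metric(2)[OF tree])
  show ?thesis
  proof (cases "m = 1")
    case True
    interpret P: connected_pair_graph "corona_K1 (path_graph m)"
      by (rule undirected_tree_metric(1)[OF undirected_tree_corona_path[OF m]])
    show ?thesis
      unfolding ecc_dist_sum_eq P.ecc_dist_sum_eq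
      using gm.eds_two_vertices P.gm.eds_two_vertices card True
      by (simp add: pverts_corona_path card_cartesian_product)
  next
    case False
    then have m2: "m \<ge> 2" using m by simp
    have "m \<le> card S" if "dominates (gdist T) S (pverts T)" for S
      using domination_number_le[OF pair_graph, of S] that dominating_set_iff dom by simp
    then obtain H l where C: "corona_metric (pverts T) (gdist T) H l"
      using corona_of_domination[OF card m2] by blast
    have "card H = m" using corona_metric.card_corona[OF C] card by simp
    then show ?thesis
      using eds_corona_le[OF tree_metric_axioms C] m2 by (simp add: ecc_dist_sum_eq eds_corona_path)
  qed
qed

theorem theorem2p11:
  fixes n :: nat
  assumes "even n" and "n > 0"
  shows "corona_K1 (path_graph (n div 2)) \<in> trees_with_domination n (n div 2) \<and>
         (\<forall>T \<in> (trees_with_domination n (n div 2) :: 'a pair_pre_digraph set).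
            ecc_dist_sum T \<le> ecc_dist_sum (corona_K1 (path_graph (n div 2))))"
proof -
  define m where "m = n div 2"
  have n: "n = 2 * m" and m: "m > 0" using assms unfolding m_def by (auto elim: evenE)
  have "n div 2 = m" by (simp add: m_def)
  then show ?thesis
    unfolding n using corona_path_mem_trees[OF m] ecc_dist_sum_le_corona_path[OF m] by auto
qed

end
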